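(* Let $X=fY$ be an $L^2$-tangential vector field on $\mathbb{S}^1$, where $f$ is a real-valued $L^2$ function and $Y(z)=iz$, and let $\mathcal{F}(X)=f*\mathbf{K}$ with $\mathbf{K}(z)=\frac{i(1-|z|^2)^3}{|1-\bar z|^2(1-\bar z)^2}$. Then $X$ is an $L^2$-boundary extension of the smooth vector field $\mathcal{F}(X)$ on the open unit disk $\mathbb{D}$.
   Context: Vector fields are identified with $\mathbb{C}$-valued functions. The normalized convolution of $f$ with the vector field $\mathbf{K}$ is the average of the rotated copies of $\mathbf{K}$ (rotated as vector fields) weighted by $f$: $$(f*\mathbf{K})(z)=\frac1{2\pi}\int_{\mathbb{S}^1}f(w)\,w\,\mathbf{K}(zw^{-1})\,dw,\quad z\in\mathbb{D},$$ where $dw$ is arc length on $\mathbb{S}^1$ (total mass $2\pi$). $X$ is an $L^2$-boundary extension of a continuous vector field $V$ on $\mathbb{D}$ if the vector fields $V_\epsilon(z)=V((1-\epsilon)z)$ on $\mathbb{S}^1$ converge to $X$ in $L^2(\mathbb{S}^1;\mathbb{C})$ as $\epsilon\to0$. *)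

theory Defs
  imports "HOL-Analysis.Analysis"
begin

(* Lebesgue measurable functions on the circle are admitted, hence the completion;
   the total mass is 2*pi. *)
definition arc_length :: "complex measure" where
  "arc_length =
     completion (distr (restrict_space lborel {0..<2*pi}) (restrict_space borel (sphere 0 1)) cis)"

definition square_integrable :: "'a measure \<Rightarrow> ('a \<Rightarrow> 'b::euclidean_space) \<Rightarrow> bool" where
  "square_integrable M f \<longleftrightarrow>
     f \<in> borel_measurable M \<and> integrable M (\<lambda>x. (norm (f x))\<^sup>2)"

definition L2_dist :: "'a measure \<Rightarrow> ('a \<Rightarrow> 'b::euclidean_space) \<Rightarrow> ('a \<Rightarrow> 'b) \<Rightarrow> real" where
  "L2_dist M f g = sqrt (\<integral>x. (norm (f x - g x))\<^sup>2 \<partial>M)"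

(* Membership in L2 is required explicitly because the Bochner integral of a
   non-integrable function is 0, which would make L2_dist meaningless. *)
definition L2_tendsto ::
  "'a measure \<Rightarrow> ('t \<Rightarrow> 'a \<Rightarrow> 'b::euclidean_space) \<Rightarrow> ('a \<Rightarrow> 'b) \<Rightarrow> 't filter \<Rightarrow> bool" where
  "L2_tendsto M F g T \<longleftrightarrow>
     square_integrable M g \<and> (\<forall>\<^sub>F t in T. square_integrable M (F t)) \<and>
     ((\<lambda>t. L2_dist M (F t) g) \<longlongrightarrow> 0) T"

(* Vector fields on subsets of the plane are complex-valued functions; their values
   outside the subset in question are irrelevant. *)
definition L2_boundary_extension :: "(complex \<Rightarrow> complex) \<Rightarrow> (complex \<Rightarrow> complex) \<Rightarrow> bool" where
  "L2_boundary_extension X V \<longleftrightarrow>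
     continuous_on (ball 0 1) V \<and>
     L2_tendsto arc_length (\<lambda>\<epsilon> z. V (of_real (1 - \<epsilon>) * z)) X (at_right (0::real))"

definition circle_convolution :: "(complex \<Rightarrow> real) \<Rightarrow> (complex \<Rightarrow> complex) \<Rightarrow> complex \<Rightarrow> complex" where
  "circle_convolution f K z =
     of_real (1 / (2 * pi)) * (\<integral>w. of_real (f w) * w * K (z * inverse w) \<partial>arc_length)"

definition rotation_field :: "complex \<Rightarrow> complex" where
  "rotation_field z = \<i> * z"

definition kernel_K :: "complex \<Rightarrow> complex" where
  "kernel_K z =
     \<i> * of_real ((1 - (cmod z)\<^sup>2) ^ 3) / (of_real ((cmod (1 - cnj z))\<^sup>2) * (1 - cnj z)\<^sup>2)"

(* Real k-fold continuous differentiability; intended for open S. *)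
primrec Ck_on :: "nat \<Rightarrow> 'a::real_normed_vector set \<Rightarrow> ('a \<Rightarrow> 'b::real_normed_vector) \<Rightarrow> bool" where
  "Ck_on 0 S f \<longleftrightarrow> continuous_on S f"
| "Ck_on (Suc k) S f \<longleftrightarrow>
     (\<forall>x\<in>S. f differentiable (at x)) \<and> (\<forall>v. Ck_on k S (\<lambda>x. frechet_derivative f (at x) v))"

definition smooth_on :: "'a::real_normed_vector set \<Rightarrow> ('a \<Rightarrow> 'b::real_normed_vector) \<Rightarrow> bool" where
  "smooth_on S f \<longleftrightarrow> (\<forall>k. Ck_on k S f)"

end

theory Submission
  imports Defs "HOL-Complex_Analysis.Cauchy_Integral_Formula"
begin

text \<open>
  For \<open>|w| = 1\<close> the rotated kernel \<open>w K(z/w)\<close> equals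
  \<open>i (1 - |z|^2)^3 / (w (w - z) cnj (w - z)^3)\<close>.  Cauchy's integral formula gives its mean over the
  circle, which is exactly \<open>i z\<close>, and its modulus \<open>(1 - |z|^2)^3 / |w - z|^4\<close> is at most four
  times the Poisson kernel.  Hence \<open>f \<mapsto> (f * K)(r \<cdot>)\<close> is bounded on \<open>L^2\<close> uniformly in
  \<open>r < 1\<close> by Schur's test, and for Lipschitz \<open>f\<close> it converges uniformly to \<open>f Y\<close> as
  \<open>r \<rightarrow> 1\<close>.  Density of Lipschitz functions in \<open>L^2\<close> gives the convergence for all \<open>f\<close>.
  Smoothness holds because the integrals of \<open>h(w) (w - z)^(-a) cnj (w - z)^(-b)\<close> are closed under
  differentiation in \<open>z\<close>, up to linear combinations.
\<close>

section \<open>Density of Lipschitz functions\<close>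

text \<open>The usual approximate-identity argument does not apply directly: the rotated kernel is
  complex-valued, so an \<open>L^1\<close> bound on its modulus replaces positivity. The factor 4
  comes from (1 - |z|^2)^2 = (1 + |z|)^2 (1 - |z|)^2 \<le> 4 |w - z|^2, which absorbs two of the
  three powers in the numerator. Schur's test needs the bound in both variables; the symmetry |w - r
  z| = |z - r w| on the circle provides the second, so squared norms grow by at most 4 * 4 = 16.
  Lipschitz functions are the dense class because the fourth power of |w - z| in the kernel yields
  an explicit rate for them, of order sqrt (1 - r^2). A further obstacle is that
  \<open>arc_length\<close> is a completion living on the circle, whereas inner regularity by
  compact sets concerns finite Borel measures on complete second-countable spaces. Density is
  therefore proved for such measures and then carried over to \<open>arc_length\<close>.\<close>

text \<open>Approximants are Lipschitz on the whole space, so the same function can be used after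
  the measure is moved from the circle to the plane. Integrability is demanded separately because
  the Bochner integral of a non-integrable function is 0.\<close>

definition Lipschitz_approximable :: "'a::metric_space measure \<Rightarrow> ('a \<Rightarrow> real) \<Rightarrow> bool" where
  "Lipschitz_approximable M f \<longleftrightarrow>
     (\<forall>e>0. \<exists>g L. L-lipschitz_on UNIV g \<and> integrable M (\<lambda>x. (f x - g x)\<^sup>2) \<and>
       (\<integral>x. (f x - g x)\<^sup>2 \<partial>M) < e)"

lemma sum_square_le: "((a::real) + b)\<^sup>2 \<le> 2 * a\<^sup>2 + 2 * b\<^sup>2"
  using sum_squares_bound[of a b] by (simp add: power2_sum)

lemma integrable_square_add:
  fixes f g :: "'a \<Rightarrow> real"
  assumes [measurable]: "f \<in> borel_measurable M" "g \<in> borel_measurable M"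
    and "integrable M (\<lambda>x. (f x)\<^sup>2)" "integrable M (\<lambda>x. (g x)\<^sup>2)"
  shows "integrable M (\<lambda>x. (f x + g x)\<^sup>2)"
    and "(\<integral>x. (f x + g x)\<^sup>2 \<partial>M) \<le> 2 * (\<integral>x. (f x)\<^sup>2 \<partial>M) + 2 * (\<integral>x. (g x)\<^sup>2 \<partial>M)"
proof -
  have i: "integrable M (\<lambda>x. 2 * (f x)\<^sup>2 + 2 * (g x)\<^sup>2)"
    using assms(3,4) by simp
  show *: "integrable M (\<lambda>x. (f x + g x)\<^sup>2)"
    by (rule Bochner_Integration.integrable_bound[OF i]) (auto intro!: AE_I2 sum_square_le)
  have "(\<integral>x. (f x + g x)\<^sup>2 \<partial>M) \<le> (\<integral>x. 2 * (f x)\<^sup>2 + 2 * (g x)\<^sup>2 \<partial>M)"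
    by (rule integral_mono[OF * i]) (rule sum_square_le)
  then show "(\<integral>x. (f x + g x)\<^sup>2 \<partial>M) \<le> 2 * (\<integral>x. (f x)\<^sup>2 \<partial>M) + 2 * (\<integral>x. (g x)\<^sup>2 \<partial>M)"
    using assms(3,4) by simp
qed

lemma Lipschitz_borel_measurable:
  fixes g :: "'a::metric_space \<Rightarrow> 'b::metric_space"
  assumes "L-lipschitz_on UNIV g" "sets M = sets borel"
  shows "g \<in> borel_measurable M"
  using borel_measurable_continuous_onI[OF lipschitz_on_continuous_on[OF assms(1)]]
    measurable_cong_sets[OF assms(2) refl] by blast

text \<open>Approximants of approximants suffice: the crude bound (a + b)^2 \<le> 2 a^2 + 2 b^2
  loses a factor that the choice e/4 repays.\<close>

lemma Lipschitz_approximable_limit: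
  assumes [measurable_cong]: "sets M = sets borel" and [measurable]: "f \<in> borel_measurable M"
    and "\<And>e. e > 0 \<Longrightarrow> \<exists>h. h \<in> borel_measurable M \<and> Lipschitz_approximable M h \<and>
      integrable M (\<lambda>x. (f x - h x)\<^sup>2) \<and> (\<integral>x. (f x - h x)\<^sup>2 \<partial>M) < e"
  shows "Lipschitz_approximable M f"
  unfolding Lipschitz_approximable_def
proof (intro allI impI)
  fix e :: real assume e: "e > 0"
  obtain h where [measurable]: "h \<in> borel_measurable M" and h: "Lipschitz_approximable M h"
      "integrable M (\<lambda>x. (f x - h x)\<^sup>2)" "(\<integral>x. (f x - h x)\<^sup>2 \<partial>M) < e/4"
    using assms(3)[of "e/4"] e by auto
  obtain g L where L: "L-lipschitz_on UNIV g" and g: "integrable M (\<lambda>x. (h x - g x)\<^sup>2)"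
      "(\<integral>x. (h x - g x)\<^sup>2 \<partial>M) < e/4"
    using h(1) e unfolding Lipschitz_approximable_def by (meson zero_less_divide_iff zero_less_numeral)
  have [measurable]: "g \<in> borel_measurable M"
    by (rule Lipschitz_borel_measurable[OF L assms(1)])
  have "integrable M (\<lambda>x. (f x - g x)\<^sup>2)" "(\<integral>x. (f x - g x)\<^sup>2 \<partial>M) < e"
    using integrable_square_add[of "\<lambda>x. f x - h x" M "\<lambda>x. h x - g x"] h g by auto
  with L show "\<exists>g L. L-lipschitz_on UNIV g \<and> integrable M (\<lambda>x. (f x - g x)\<^sup>2) \<and>
      (\<integral>x. (f x - g x)\<^sup>2 \<partial>M) < e" by blast
qed

lemma Lipschitz_approximable_add:
  assumes [measurable_cong]: "sets M = sets borel"
    and [measurable]: "f \<in> borel_measurable M" "g \<in> borel_measurable M"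
    and "Lipschitz_approximable M f" "Lipschitz_approximable M g"
  shows "Lipschitz_approximable M (\<lambda>x. f x + g x)"
  unfolding Lipschitz_approximable_def
proof (intro allI impI)
  fix e :: real assume e: "e > 0"
  obtain f' L where L: "L-lipschitz_on UNIV f'" and f: "integrable M (\<lambda>x. (f x - f' x)\<^sup>2)"
      "(\<integral>x. (f x - f' x)\<^sup>2 \<partial>M) < e/4"
    using assms(4) e unfolding Lipschitz_approximable_def by (meson zero_less_divide_iff zero_less_numeral)
  obtain g' L' where L': "L'-lipschitz_on UNIV g'" and g: "integrable M (\<lambda>x. (g x - g' x)\<^sup>2)"
      "(\<integral>x. (g x - g' x)\<^sup>2 \<partial>M) < e/4"
    using assms(5) e unfolding Lipschitz_approximable_def by (meson zero_less_divide_iff zero_less_numeral)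
  have [measurable]: "f' \<in> borel_measurable M" "g' \<in> borel_measurable M"
    using Lipschitz_borel_measurable assms(1) L L' by auto
  have eq: "f x - f' x + (g x - g' x) = f x + g x - (f' x + g' x)" for x by simp
  have "integrable M (\<lambda>x. (f x + g x - (f' x + g' x))\<^sup>2)"
      "(\<integral>x. (f x + g x - (f' x + g' x))\<^sup>2 \<partial>M) < e"
    using integrable_square_add[of "\<lambda>x. f x - f' x" M "\<lambda>x. g x - g' x"] f g
    unfolding eq by auto
  moreover have "(L + L')-lipschitz_on UNIV (\<lambda>x. f' x + g' x)"
    by (rule lipschitz_on_add[OF L L'])
  ultimately show "\<exists>h K. K-lipschitz_on UNIV h \<and> integrable M (\<lambda>x. (f x + g x - h x)\<^sup>2) \<and>
      (\<integral>x. (f x + g x - h x)\<^sup>2 \<partial>M) < e" by blast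
qed

lemma Lipschitz_approximable_cmult:
  assumes "Lipschitz_approximable M f"
  shows "Lipschitz_approximable M (\<lambda>x. c * f x)"
  unfolding Lipschitz_approximable_def
proof (intro allI impI)
  fix e :: real assume e: "e > 0"
  \<comment> \<open>Dividing e by c^2 + 1 rather than c^2 also covers c = 0.\<close>
  have c: "c\<^sup>2 + 1 > 0" by (simp add: add_nonneg_pos)
  then have "e / (c\<^sup>2 + 1) > 0" using e by simp
  then obtain g L where L: "L-lipschitz_on UNIV g" and g: "integrable M (\<lambda>x. (f x - g x)\<^sup>2)"
      "(\<integral>x. (f x - g x)\<^sup>2 \<partial>M) < e / (c\<^sup>2 + 1)"
    using assms unfolding Lipschitz_approximable_def by blast
  have eq: "(c * f x - c * g x)\<^sup>2 = c\<^sup>2 * (f x - g x)\<^sup>2" for x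
    by (simp add: right_diff_distrib[symmetric] power_mult_distrib)
  have "c\<^sup>2 * (\<integral>x. (f x - g x)\<^sup>2 \<partial>M) \<le> (c\<^sup>2 + 1) * (\<integral>x. (f x - g x)\<^sup>2 \<partial>M)"
    by (intro mult_right_mono) auto
  also have "\<dots> < e" using g(2) c by (simp add: pos_less_divide_eq mult.commute)
  finally have "(\<integral>x. (c * f x - c * g x)\<^sup>2 \<partial>M) < e" unfolding eq by simp
  moreover have "integrable M (\<lambda>x. (c * f x - c * g x)\<^sup>2)" unfolding eq using g(1) by simp
  moreover have "(\<bar>c\<bar> * L)-lipschitz_on UNIV (\<lambda>x. c * g x)"
    using lipschitz_on_cmult_real[OF L] by simp
  ultimately show "\<exists>h K. K-lipschitz_on UNIV h \<and> integrable M (\<lambda>x. (c * f x - h x)\<^sup>2) \<and>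
      (\<integral>x. (c * f x - h x)\<^sup>2 \<partial>M) < e" by blast
qed

text \<open>Serves both limit arguments below, tents shrinking to a compact set and increasing
  sequences of functions: the majorant \<open>h\<close> of the squared errors turns pointwise into
  \<open>L^2\<close> convergence.\<close>

lemma Lipschitz_approximable_dominated:
  fixes f :: "'a::metric_space \<Rightarrow> real"
  assumes [measurable_cong]: "sets M = sets borel" and [measurable]: "f \<in> borel_measurable M"
    and U[measurable]: "\<And>i. U i \<in> borel_measurable M"
    and U': "\<And>i. Lipschitz_approximable M (U i)"
    and lim: "\<And>x. x \<in> space M \<Longrightarrow> (\<lambda>i. U i x) \<longlonglongrightarrow> f x"
    and h: "integrable M h" "\<And>i x. x \<in> space M \<Longrightarrow> (f x - U i x)\<^sup>2 \<le> h x"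
  shows "Lipschitz_approximable M f"
proof (rule Lipschitz_approximable_limit[OF assms(1,2)])
  fix e :: real assume e: "e > 0"
  have *: "(\<lambda>i. \<integral>x. (f x - U i x)\<^sup>2 \<partial>M) \<longlonglongrightarrow> (\<integral>x. 0 \<partial>M)"
  proof (rule integral_dominated_convergence[where w = h])
    show "AE x in M. (\<lambda>i. (f x - U i x)\<^sup>2) \<longlonglongrightarrow> 0"
    proof (rule AE_I2)
      fix x assume "x \<in> space M"
      from tendsto_power[OF tendsto_diff[OF tendsto_const[of "f x"] lim[OF this]], of 2]
      show "(\<lambda>i. (f x - U i x)\<^sup>2) \<longlonglongrightarrow> 0" by simp
    qed
  qed (use h in auto)
  have i: "integrable M (\<lambda>x. (f x - U i x)\<^sup>2)" for i
    by (rule Bochner_Integration.integrable_bound[OF h(1)])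
      (use h(2) in \<open>auto intro!: AE_I2 order_trans[OF h(2) abs_ge_self]\<close>)
  from * e have "eventually (\<lambda>i. (\<integral>x. (f x - U i x)\<^sup>2 \<partial>M) < e) sequentially"
    by (auto dest!: order_tendstoD(2))
  then obtain i where "(\<integral>x. (f x - U i x)\<^sup>2 \<partial>M) < e"
    by (auto simp: eventually_sequentially)
  with i U U' show "\<exists>h. h \<in> borel_measurable M \<and> Lipschitz_approximable M h \<and>
      integrable M (\<lambda>x. (f x - h x)\<^sup>2) \<and> (\<integral>x. (f x - h x)\<^sup>2 \<partial>M) < e" by blast
qed

lemma Lipschitz_imp_approximable: "L-lipschitz_on UNIV g \<Longrightarrow> Lipschitz_approximable M g"
  unfolding Lipschitz_approximable_def by (auto intro!: exI[of _ g])

text \<open>The tents max 0 (1 - n * dist (x, K)) are n-Lipschitz, equal 1 on K and, as K is closed,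
  vanish at each point outside K for large n.\<close>

lemma Lipschitz_approximable_indicator_compact:
  assumes [measurable_cong]: "sets M = sets borel" and "finite_measure M" and K: "compact K"
  shows "Lipschitz_approximable M (indicator K)"
\<comment> \<open>\<open>infdist\<close> to the empty set is 0 by convention, which would make every
  tent constantly 1.\<close>
proof (cases "K = {}")
  case True
  then show ?thesis
    using Lipschitz_imp_approximable[OF lipschitz_on_constant[where c = "0::real"], of M]
    by (simp add: indicator_def[abs_def])
next
  case False
  interpret finite_measure M by fact
  have cl: "closed K" using K by (rule compact_imp_closed)
  have K_sets: "K \<in> sets M" using cl assms(1) by (simp add: borel_closed)
  define U where "U n x = max 0 (1 - real n * infdist x K)" for n :: nat and x
  have lip: "(real n)-lipschitz_on UNIV (U n)" for n
  proof (rule lipschitz_onI)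
    fix x y
    have "\<bar>infdist x K - infdist y K\<bar> \<le> dist x y"
      using infdist_triangle_abs by blast
    then have "\<bar>real n * infdist x K - real n * infdist y K\<bar> \<le> real n * dist x y"
      by (simp add: right_diff_distrib[symmetric] abs_mult mult_left_mono)
    then show "dist (U n x) (U n y) \<le> real n * dist x y"
      unfolding U_def dist_real_def by linarith
  qed simp
  show ?thesis
  proof (rule Lipschitz_approximable_dominated[where U = U and h = "\<lambda>_. 1"])
    show "U i \<in> borel_measurable M" for i
      by (rule Lipschitz_borel_measurable[OF lip assms(1)])
    show "Lipschitz_approximable M (U i)" for i
      by (rule Lipschitz_imp_approximable[OF lip])
    show "(\<lambda>i. U i x) \<longlonglongrightarrow> indicator K x" for x
    proof (cases "x \<in> K")
      case True then show ?thesis by (simp add: U_def)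
    next
      case nx: False
      have pos: "infdist x K > 0"
        using infdist_pos_not_in_closed[OF cl False nx] .
      obtain N where N: "1 < real N * infdist x K"
        using reals_Archimedean3[OF pos] by blast
      have "U n x = 0" if "n \<ge> N" for n
      proof -
        have "real N * infdist x K \<le> real n * infdist x K"
          using that pos by (intro mult_right_mono) auto
        then show ?thesis using N by (simp add: U_def)
      qed
      then have "eventually (\<lambda>n. U n x = 0) sequentially"
        by (auto simp: eventually_sequentially)
      then show ?thesis using nx by (simp add: tendsto_eventually)
    qed
    show "(indicator K x - U i x)\<^sup>2 \<le> 1" for i x
      by (cases "x \<in> K") (auto simp: U_def abs_square_le_1 infdist_nonneg)
  qed (use assms K_sets in auto)
qed

text \<open>Inner regularity gives a compact K inside A with A - K of measure below e, and this
  measure is the squared distance between the two indicators.\<close>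

lemma Lipschitz_approximable_indicator:
  fixes M :: "'a::{second_countable_topology, complete_space} measure"
  assumes sets: "sets M = sets borel" and "finite_measure M" and A: "A \<in> sets M"
  shows "Lipschitz_approximable M (indicator A)"
proof (rule Lipschitz_approximable_limit[OF sets])
  interpret finite_measure M by fact
  fix e :: real assume e: "e > 0"
  have "emeasure M A = (SUP K \<in> {K. K \<subseteq> A \<and> compact K}. emeasure M K)"
    by (rule inner_regular) (use sets A in auto)
  then have "\<exists>K \<in> {K. K \<subseteq> A \<and> compact K}. emeasure M A < emeasure M K + ennreal e"
  proof (rule SUP_approx_ennreal[OF e, rotated])
    show "{K. K \<subseteq> A \<and> compact K} \<noteq> {}" using compact_empty by blast
    show "emeasure M A \<noteq> \<infinity>" by simp
  qed
  then obtain K where K: "K \<subseteq> A" "compact K" "emeasure M A < emeasure M K + ennreal e"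
    by blast
  have Ks: "K \<in> sets M" using K sets by (simp add: borel_compact)
  have "measure M (A - K) < e"
    using K(3) e by (simp add: emeasure_eq_measure finite_measure_Diff[OF A Ks K(1)]
        ennreal_plus[symmetric] ennreal_less_iff del: ennreal_plus)
  moreover have eq: "(indicator A x - indicator K x)\<^sup>2 = (indicator (A - K) x :: real)" for x
    using K(1) by (auto simp: indicator_def)
  ultimately show "\<exists>h. h \<in> borel_measurable M \<and> Lipschitz_approximable M h \<and>
      integrable M (\<lambda>x. (indicator A x - h x)\<^sup>2) \<and> (\<integral>x. (indicator A x - h x)\<^sup>2 \<partial>M) < e"
    using A Ks Lipschitz_approximable_indicator_compact[OF sets \<open>finite_measure M\<close> K(2)]
    by (intro exI[of _ "indicator K"]) (auto simp: emeasure_eq_measure)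
qed (use A in simp)

lemma Lipschitz_dense_L2:
  fixes M :: "'a::{second_countable_topology, complete_space} measure" and f :: "'a \<Rightarrow> real"
  assumes sets: "sets M = sets borel" and fin: "finite_measure M"
    and f[measurable]: "f \<in> borel_measurable M" and f2: "integrable M (\<lambda>x. (f x)\<^sup>2)"
  shows "Lipschitz_approximable M f"
proof -
  \<comment> \<open>Square integrability stays a premise of the induction, so each case has to
    recover it for the pieces; nonnegativity does this through u, v \<le> u + v and
    \<open>U i \<le> u\<close>.\<close>
  have nonneg: "Lipschitz_approximable M u" if "u \<in> borel_measurable M" "\<And>x. 0 \<le> u x"
    "integrable M (\<lambda>x. (u x)\<^sup>2)" for u :: "'a \<Rightarrow> real"
    using that
  proof (induction u rule: borel_measurable_induct_real)
    case (set A)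
    then show ?case by (intro Lipschitz_approximable_indicator[OF sets fin])
  next
    case (mult u c)
    show ?case
    \<comment> \<open>For c = 0 the premise on c * u carries no information about u.\<close>
    proof (cases "c = 0")
      case True then show ?thesis
        using Lipschitz_imp_approximable[OF lipschitz_on_constant[where c = "0::real"], of M] by simp
    next
      case False
      then have "integrable M (\<lambda>x. (u x)\<^sup>2)"
        using mult.prems by (simp add: power_mult_distrib)
      with mult show ?thesis by (intro Lipschitz_approximable_cmult)
    qed
  next
    case (add u v)
    note [measurable] = add.hyps(1,3)
    have "integrable M (\<lambda>x. (u x)\<^sup>2)" "integrable M (\<lambda>x. (v x)\<^sup>2)"
      by (rule Bochner_Integration.integrable_bound[OF add.prems];
          use add.hyps in \<open>auto intro!: AE_I2 power_mono\<close>)+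
    with add show ?case by (intro Lipschitz_approximable_add[OF sets]) auto
  next
    case (seq U)
    note [measurable] = seq.hyps(1)
    have U_le: "U i x \<le> u x" if "x \<in> space M" for x i
      using seq that by (intro incseq_le) (auto simp: incseq_def le_fun_def)
    have U2: "integrable M (\<lambda>x. (U i x)\<^sup>2)" for i
      by (rule Bochner_Integration.integrable_bound[OF seq.prems])
        (use seq.hyps U_le in \<open>auto intro!: AE_I2 power_mono\<close>)
    have u: "u \<in> borel_measurable M"
      by (rule borel_measurable_LIMSEQ_real[where u = U]) (use seq in auto)
    show ?case
    proof (rule Lipschitz_approximable_dominated[OF sets u, where U = U and h = "\<lambda>x. (u x)\<^sup>2"])
      show "(u x - U i x)\<^sup>2 \<le> (u x)\<^sup>2" if "x \<in> space M" for i x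
        using seq.hyps(2)[of i x] U_le[OF that, of i] by (intro power_mono) auto
      show "Lipschitz_approximable M (U i)" for i
        by (rule seq.IH[OF U2])
    qed (fact seq)+
  qed
  have part: "integrable M (\<lambda>x. (max 0 (f x))\<^sup>2)" "integrable M (\<lambda>x. (max 0 (- f x))\<^sup>2)"
    by (rule Bochner_Integration.integrable_bound[OF f2]; auto simp: max_def)+
  have "Lipschitz_approximable M (\<lambda>x. max 0 (f x) + (-1) * max 0 (- f x))"
    by (intro Lipschitz_approximable_add[OF sets] Lipschitz_approximable_cmult nonneg part) simp_all
  moreover have "max 0 (f x) + (-1) * max 0 (- f x) = f x" for x by (simp add: max_def)
  ultimately show ?thesis by simp
qed

section \<open>Smooth functions and integrals with parameters\<close>

lemma Ck_on_cong:
  assumes "open S" "\<And>x. x \<in> S \<Longrightarrow> f x = g x" "Ck_on k S f"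
  shows "Ck_on k S g"
  using assms(2,3)
proof (induction k arbitrary: f g)
  case 0
  then show ?case by (auto cong: continuous_on_cong)
next
  case (Suc k)
  note f = Suc.prems(2)[THEN Ck_on.simps(2)[THEN iffD1]]
  have D: "(g has_derivative frechet_derivative f (at x)) (at x)" if "x \<in> S" for x
  proof (rule has_derivative_transform_within_open[OF _ \<open>open S\<close> that])
    show "(f has_derivative frechet_derivative f (at x)) (at x)"
      using f[THEN conjunct1] that by (simp only: frechet_derivative_works[symmetric])
  qed (rule Suc.prems(1))
  then have eq: "frechet_derivative g (at x) = frechet_derivative f (at x)" if "x \<in> S" for x
    using that by (metis frechet_derivative_at)
  have "Ck_on k S (\<lambda>x. frechet_derivative g (at x) v)" for v
    by (rule Suc.IH[OF _ f[THEN conjunct2, THEN spec, of v]]) (simp only: eq)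
  with D show ?case
    by (intro Ck_on.simps(2)[THEN iffD2] conjI ballI allI differentiableI)
qed

text \<open>\<open>Ck_on\<close> is phrased with the choice operator
  \<open>frechet_derivative\<close>; uniqueness of the derivative lets any explicit derivative take
  its place.\<close>

lemma Ck_on_SucI:
  assumes "open S" "\<And>x. x \<in> S \<Longrightarrow> (f has_derivative D x) (at x)" "\<And>v. Ck_on k S (\<lambda>x. D x v)"
  shows "Ck_on (Suc k) S f"
proof -
  have "frechet_derivative f (at x) = D x" if "x \<in> S" for x
    using assms(2)[OF that] by (metis frechet_derivative_at)
  with assms show ?thesis
    by (auto simp: differentiable_def intro!: Ck_on_cong[OF assms(1) _ assms(3)])
qed

lemma Ck_on_SucE:
  assumes "Ck_on (Suc k) S f"
  obtains D where "\<And>x. x \<in> S \<Longrightarrow> (f has_derivative D x) (at x)" "\<And>v. Ck_on k S (\<lambda>x. D x v)"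
  using that[of "\<lambda>x. frechet_derivative f (at x)"] assms
  by (auto simp: frechet_derivative_works[symmetric])

lemma Ck_on_Suc_imp: "Ck_on (Suc k) S f \<Longrightarrow> Ck_on k S f"
proof (induction k arbitrary: f)
  case 0
  then show ?case
    by (auto intro!: differentiable_imp_continuous_on simp: differentiable_on_def
        differentiable_at_withinI)
next
  case (Suc k)
  note f = Suc.prems[THEN Ck_on.simps(2)[THEN iffD1]]
  have "Ck_on k S (\<lambda>x. frechet_derivative f (at x) v)" for v
    by (rule Suc.IH[OF f[THEN conjunct2, THEN spec]])
  then show ?case
    by (intro Ck_on.simps(2)[THEN iffD2] conjI allI f[THEN conjunct1])
qed

lemma Ck_on_const: "Ck_on k S (\<lambda>_. c)"
  by (induction k arbitrary: c) auto

lemma Ck_on_bounded_linear: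
  assumes "bounded_linear f" "open S"
  shows "Ck_on k S f"
proof (cases k)
  case 0
  then show ?thesis using assms by (auto intro: linear_continuous_on)
next
  case (Suc n)
  show ?thesis unfolding Suc
    by (rule Ck_on_SucI[OF assms(2), of _ "\<lambda>_. f"])
      (auto intro: Ck_on_const bounded_linear_imp_has_derivative assms)
qed

lemma Ck_on_add:
  assumes "open S" "Ck_on k S f" "Ck_on k S g"
  shows "Ck_on k S (\<lambda>x. f x + g x)"
  using assms(2,3)
proof (induction k arbitrary: f g)
  case 0
  then show ?case by (auto intro: continuous_on_add)
next
  case (Suc k)
  obtain D E where D: "\<And>x. x \<in> S \<Longrightarrow> (f has_derivative D x) (at x)" "\<And>v. Ck_on k S (\<lambda>x. D x v)"
    and E: "\<And>x. x \<in> S \<Longrightarrow> (g has_derivative E x) (at x)" "\<And>v. Ck_on k S (\<lambda>x. E x v)"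
    using Suc.prems by (elim Ck_on_SucE) blast
  show ?case
    by (rule Ck_on_SucI[OF assms(1) has_derivative_add[OF D(1) E(1)] Suc.IH[OF D(2) E(2)]])
qed

lemma Ck_on_mult:
  fixes f g :: "'a::real_normed_vector \<Rightarrow> 'b::real_normed_algebra"
  assumes "open S" "Ck_on k S f" "Ck_on k S g"
  shows "Ck_on k S (\<lambda>x. f x * g x)"
  using assms(2,3)
proof (induction k arbitrary: f g)
  case 0
  then show ?case by (auto intro: continuous_on_mult)
next
  case (Suc k)
  obtain D E where D: "\<And>x. x \<in> S \<Longrightarrow> (f has_derivative D x) (at x)" "\<And>v. Ck_on k S (\<lambda>x. D x v)"
    and E: "\<And>x. x \<in> S \<Longrightarrow> (g has_derivative E x) (at x)" "\<And>v. Ck_on k S (\<lambda>x. E x v)"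
    using Suc.prems by (elim Ck_on_SucE) blast
  show ?case
    by (rule Ck_on_SucI[OF assms(1) has_derivative_mult[OF D(1) E(1)]
        Ck_on_add[OF assms(1) Suc.IH Suc.IH]])
      (use D(2) E(2) Suc.prems Ck_on_Suc_imp in blast)+
qed

lemma Ck_on_power:
  fixes f :: "'a::real_normed_vector \<Rightarrow> 'b::real_normed_algebra_1"
  assumes "open S" "Ck_on k S f"
  shows "Ck_on k S (\<lambda>x. f x ^ n)"
  by (induction n) (auto intro: Ck_on_const Ck_on_mult assms)

text \<open>Dominated convergence is applied to the difference quotients. Convexity of S turns the
  derivative bound into a Lipschitz bound in y by the mean value inequality, whence the majorant 2 *
  B w.\<close>

lemma has_derivative_integral:
  fixes \<phi> :: "'a::real_normed_vector \<Rightarrow> 'w \<Rightarrow> 'b::{banach, second_countable_topology}"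
  assumes S: "open S" "convex S" "x \<in> S"
    and D: "\<And>y w. y \<in> S \<Longrightarrow> w \<in> space M \<Longrightarrow> ((\<lambda>y. \<phi> y w) has_derivative D y w) (at y)"
    and B: "\<And>y w. y \<in> S \<Longrightarrow> w \<in> space M \<Longrightarrow> onorm (D y w) \<le> B w" "integrable M B"
    and int: "\<And>y. y \<in> S \<Longrightarrow> integrable M (\<phi> y)"
    and meas: "\<And>v. (\<lambda>w. D x w v) \<in> borel_measurable M"
  shows "((\<lambda>y. \<integral>w. \<phi> y w \<partial>M) has_derivative (\<lambda>v. \<integral>w. D x w v \<partial>M)) (at x)"
proof -
  have bl: "bounded_linear (D y w)" if "y \<in> S" "w \<in> space M" for y w
    using D[OF that] by (rule has_derivative_bounded_linear)
  have Dle: "norm (D x w v) \<le> B w * norm v" if "w \<in> space M" for w v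
    using onorm[OF bl[OF S(3) that], of v] B(1)[OF S(3) that]
    by (meson mult_right_mono norm_ge_zero order_trans)
  have Dint: "integrable M (\<lambda>w. D x w v)" for v
    by (rule Bochner_Integration.integrable_bound[of M "\<lambda>w. B w * norm v"])
      (use B(2) Dle meas in \<open>auto intro!: AE_I2 order_trans[OF Dle abs_ge_self]\<close>)
  have lin: "bounded_linear (\<lambda>v. \<integral>w. D x w v \<partial>M)"
  proof (rule bounded_linear_intro[where K = "\<integral>w. B w \<partial>M"])
    fix u v and r :: real
    have "(\<integral>w. D x w (u + v) \<partial>M) = (\<integral>w. D x w u + D x w v \<partial>M)"
      by (intro Bochner_Integration.integral_cong refl)
        (use bl[OF S(3)] bounded_linear.linear linear_add in blast)
    then show "(\<integral>w. D x w (u + v) \<partial>M) = (\<integral>w. D x w u \<partial>M) + (\<integral>w. D x w v \<partial>M)"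
      using Dint by simp
    have "(\<integral>w. D x w (r *\<^sub>R v) \<partial>M) = (\<integral>w. r *\<^sub>R D x w v \<partial>M)"
      by (intro Bochner_Integration.integral_cong refl)
        (use bl[OF S(3)] bounded_linear.linear linear_cmul in blast)
    then show "(\<integral>w. D x w (r *\<^sub>R v) \<partial>M) = r *\<^sub>R (\<integral>w. D x w v \<partial>M)"
      by simp
    have "norm (\<integral>w. D x w v \<partial>M) \<le> (\<integral>w. norm (D x w v) \<partial>M)"
      by (rule integral_norm_bound)
    also have "\<dots> \<le> (\<integral>w. B w * norm v \<partial>M)"
      by (rule integral_mono) (use B(2) Dle Dint in auto)
    finally show "norm (\<integral>w. D x w v \<partial>M) \<le> norm v * (\<integral>w. B w \<partial>M)"
      by (simp add: mult.commute)
  qed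
  have lip: "norm (\<phi> y w - \<phi> x w) \<le> B w * norm (y - x)" if "y \<in> S" "w \<in> space M" for y w
    using S(2) has_derivative_at_withinI[OF D[OF _ that(2)]] B(1)[OF _ that(2)] that(1) S(3)
    by (rule differentiable_bound)
  define q where "q y w = (\<phi> y w - \<phi> x w - D x w (y - x)) /\<^sub>R norm (y - x)" for y w
  have q_le: "norm (q y w) \<le> 2 * B w" if "y \<in> S" "w \<in> space M" for y w
  proof (cases "y = x")
    case True
    have "0 \<le> B w"
      using order_trans[OF onorm_pos_le[OF bl[OF S(3) that(2)]] B(1)[OF S(3) that(2)]] .
    then show ?thesis using True by (simp add: q_def)
  next
    case False
    have "norm (\<phi> y w - \<phi> x w - D x w (y - x)) \<le> B w * norm (y - x) + B w * norm (y - x)"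
      using norm_triangle_ineq4 lip[OF that] Dle[OF that(2)] by (meson add_mono order_trans)
    then show ?thesis using False by (simp add: q_def divide_simps mult_ac)
  qed
  have q_int: "integrable M (q y)" if "y \<in> S" for y
    unfolding q_def
    by (intro integrable_scaleR_right Bochner_Integration.integrable_diff int Dint that S(3))
  have "((\<lambda>y. \<integral>w. q y w \<partial>M) \<longlongrightarrow> 0) (at x)"
    unfolding tendsto_at_iff_sequentially comp_def
  proof (intro allI impI)
    fix X assume X: "\<forall>i. X i \<in> UNIV - {x}" "X \<longlonglongrightarrow> x"
    then obtain N where N: "\<And>n. n \<ge> N \<Longrightarrow> X n \<in> S"
      using S by (metis eventually_sequentially topological_tendstoD)
    \<comment> \<open>The bounds hold only in S, which the sequence enters eventually, so a tail of
      it is used.\<close>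
    let ?X = "\<lambda>n. X (n + N)"
    have X': "?X \<longlonglongrightarrow> x" by (rule LIMSEQ_ignore_initial_segment[OF X(2)])
    have "(\<lambda>n. \<integral>w. q (?X n) w \<partial>M) \<longlonglongrightarrow> (\<integral>w. 0 \<partial>M)"
    proof (rule integral_dominated_convergence[where w = "\<lambda>w. 2 * B w"])
      show "AE w in M. (\<lambda>n. q (?X n) w) \<longlonglongrightarrow> 0"
      proof (rule AE_I2)
        fix w assume "w \<in> space M"
        from D[OF S(3) this] have "((\<lambda>y. q y w) \<longlongrightarrow> 0) (at x)"
          unfolding q_def has_derivative_iff_norm
          by - (rule tendsto_norm_zero_cancel, simp add: divide_inverse mult.commute)
        then show "(\<lambda>n. q (?X n) w) \<longlonglongrightarrow> 0"
          unfolding tendsto_at_iff_sequentially comp_def using X X' by auto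
      qed
    qed (use N q_int q_le B(2) in \<open>auto intro!: borel_measurable_integrable\<close>)
    then show "(\<lambda>n. \<integral>w. q (X n) w \<partial>M) \<longlonglongrightarrow> 0"
      using LIMSEQ_offset[of "\<lambda>n. \<integral>w. q (X n) w \<partial>M" N] by simp
  qed
  moreover have "(\<integral>w. q y w \<partial>M) = ((\<integral>w. \<phi> y w \<partial>M) - (\<integral>w. \<phi> x w \<partial>M) - (\<integral>w. D x w (y - x) \<partial>M))
      /\<^sub>R norm (y - x)" if "y \<in> S" for y
    unfolding q_def using int[OF that] int[OF S(3)] Dint by simp
  ultimately have *: "((\<lambda>y. ((\<integral>w. \<phi> y w \<partial>M) - (\<integral>w. \<phi> x w \<partial>M) - (\<integral>w. D x w (y - x) \<partial>M))
      /\<^sub>R norm (y - x)) \<longlongrightarrow> 0) (at x)"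
    using S by (elim Lim_transform_within_open) auto
  have norm_q: "norm (u /\<^sub>R norm v) = norm u / norm v" for u :: 'b and v :: 'a
    by (simp add: divide_inverse mult.commute)
  show ?thesis
    unfolding has_derivative_iff_norm
    using lin tendsto_norm_zero[OF *, unfolded norm_q] by blast
qed

section \<open>Schur's test\<close>

text \<open>Cauchy-Schwarz for the splitting k u = sqrt k * (sqrt k u) and the row bound give C
  times the integral of k u^2; Tonelli and the column bound finish.\<close>

lemma Schur_test:
  fixes k :: "'a \<Rightarrow> 'b \<Rightarrow> real" and u :: "'b \<Rightarrow> ennreal"
  assumes "sigma_finite_measure M" "sigma_finite_measure N"
    and [measurable]: "case_prod k \<in> borel_measurable (M \<Otimes>\<^sub>M N)" "u \<in> borel_measurable N"
    and nonneg: "\<And>x y. x \<in> space M \<Longrightarrow> y \<in> space N \<Longrightarrow> 0 \<le> k x y"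
    and row: "\<And>x. x \<in> space M \<Longrightarrow> (\<integral>\<^sup>+y. ennreal (k x y) \<partial>N) \<le> C"
    and col: "\<And>y. y \<in> space N \<Longrightarrow> (\<integral>\<^sup>+x. ennreal (k x y) \<partial>M) \<le> D"
  shows "(\<integral>\<^sup>+x. (\<integral>\<^sup>+y. ennreal (k x y) * u y \<partial>N)\<^sup>2 \<partial>M) \<le> C * D * (\<integral>\<^sup>+y. (u y)\<^sup>2 \<partial>N)"
proof -
  interpret pair_sigma_finite M N using assms(1,2) by (simp add: pair_sigma_finite_def)
  have pointwise: "(\<integral>\<^sup>+y. ennreal (k x y) * u y \<partial>N)\<^sup>2 \<le> C * (\<integral>\<^sup>+y. ennreal (k x y) * (u y)\<^sup>2 \<partial>N)"
    if x: "x \<in> space M" for x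
  proof -
    have sq: "ennreal (sqrt (k x y)) * ennreal (sqrt (k x y)) = ennreal (k x y)" if "y \<in> space N" for y
      using nonneg[OF x that] by (simp add: ennreal_mult[symmetric])
    have [measurable]: "k x \<in> borel_measurable N"
      using measurable_compose_Pair1[OF x assms(3)] by simp
    have "(\<integral>\<^sup>+y. ennreal (k x y) * u y \<partial>N)\<^sup>2 =
        (\<integral>\<^sup>+y. ennreal (sqrt (k x y)) * (ennreal (sqrt (k x y)) * u y) \<partial>N)\<^sup>2"
      by (intro arg_cong[where f = "\<lambda>t. t\<^sup>2"] nn_integral_cong) (simp add: mult.assoc[symmetric] sq)
    also have "\<dots> \<le> (\<integral>\<^sup>+y. (ennreal (sqrt (k x y)))\<^sup>2 \<partial>N) * (\<integral>\<^sup>+y. (ennreal (sqrt (k x y)) * u y)\<^sup>2 \<partial>N)"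
      by (rule Cauchy_Schwarz_nn_integral) auto
    also have "\<dots> = (\<integral>\<^sup>+y. ennreal (k x y) \<partial>N) * (\<integral>\<^sup>+y. ennreal (k x y) * (u y)\<^sup>2 \<partial>N)"
      by (intro arg_cong2[where f = "(*)"] nn_integral_cong)
        (simp_all only: power_mult_distrib power2_eq_square[of "ennreal (sqrt _)"] sq)
    also have "\<dots> \<le> C * (\<integral>\<^sup>+y. ennreal (k x y) * (u y)\<^sup>2 \<partial>N)"
      by (intro mult_right_mono row x) simp
    finally show ?thesis .
  qed
  have "(\<integral>\<^sup>+x. (\<integral>\<^sup>+y. ennreal (k x y) * u y \<partial>N)\<^sup>2 \<partial>M) \<le>
      (\<integral>\<^sup>+x. C * (\<integral>\<^sup>+y. ennreal (k x y) * (u y)\<^sup>2 \<partial>N) \<partial>M)"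
    by (intro nn_integral_mono pointwise)
  also have "\<dots> = C * (\<integral>\<^sup>+x. \<integral>\<^sup>+y. ennreal (k x y) * (u y)\<^sup>2 \<partial>N \<partial>M)"
    by (intro nn_integral_cmult) measurable
  also have "(\<integral>\<^sup>+x. \<integral>\<^sup>+y. ennreal (k x y) * (u y)\<^sup>2 \<partial>N \<partial>M) =
      (\<integral>\<^sup>+y. \<integral>\<^sup>+x. ennreal (k x y) * (u y)\<^sup>2 \<partial>M \<partial>N)"
    by (rule Fubini'[symmetric]) measurable
  also have "\<dots> = (\<integral>\<^sup>+y. (\<integral>\<^sup>+x. ennreal (k x y) \<partial>M) * (u y)\<^sup>2 \<partial>N)"
    by (intro nn_integral_cong nn_integral_multc) measurable
  also have "\<dots> \<le> (\<integral>\<^sup>+y. D * (u y)\<^sup>2 \<partial>N)"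
    by (intro nn_integral_mono mult_right_mono col) auto
  also have "\<dots> = D * (\<integral>\<^sup>+y. (u y)\<^sup>2 \<partial>N)"
    by (intro nn_integral_cmult) measurable
  finally show ?thesis
    by (simp add: mult.assoc mult_left_mono)
qed

section \<open>The kernel on the circle\<close>

lemma cis_measurable_arc:
  "cis \<in> restrict_space lborel {0..<2*pi} \<rightarrow>\<^sub>M restrict_space borel (sphere 0 1)"
proof (rule measurable_restrict_space2)
  show "cis \<in> restrict_space lborel {0..<2*pi} \<rightarrow>\<^sub>M borel"
    by (intro measurable_restrict_space1) (simp add: borel_measurable_continuous_onI continuous_intros)
qed auto

lemma space_arc_length [simp]: "space arc_length = sphere 0 1"
  by (simp add: arc_length_def space_completion space_restrict_space)

lemma ident_measurable_arc_length: "(\<lambda>w. w) \<in> arc_length \<rightarrow>\<^sub>M borel"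
  unfolding arc_length_def
  by (rule measurable_completion) (simp add: measurable_restrict_space1)

lemma continuous_on_measurable_arc_length:
  assumes "continuous_on (sphere 0 1) h"
  shows "h \<in> borel_measurable arc_length"
  unfolding arc_length_def
  by (rule measurable_completion)
    (use borel_measurable_continuous_on_restrict[OF assms] in simp)

lemma emeasure_arc_length: "emeasure arc_length (sphere 0 1) = ennreal (2 * pi)"
proof -
  have "emeasure arc_length (sphere 0 1) = (\<integral>\<^sup>+ w. 1 \<partial>arc_length)"
    by (simp only: nn_integral_const space_arc_length mult_1)
  also have "\<dots> = (\<integral>\<^sup>+ t. 1 \<partial>restrict_space lborel {0..<2*pi})"
    unfolding arc_length_def nn_integral_completion
    by (rule nn_integral_distr[OF cis_measurable_arc]) simp
  also have "\<dots> = ennreal (2 * pi)"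
    by (simp add: space_restrict_space emeasure_restrict_space)
  finally show ?thesis .
qed

lemma finite_measure_arc_length: "finite_measure arc_length"
  by (rule finite_measureI) (simp add: emeasure_arc_length)

lemma continuous_on_integrable_arc_length:
  fixes h :: "complex \<Rightarrow> 'b::{banach, second_countable_topology}"
  assumes "continuous_on (sphere 0 1) h"
  shows "integrable arc_length h"
proof -
  have "bounded (h ` sphere 0 1)"
    by (intro compact_imp_bounded compact_continuous_image assms) simp
  then obtain B where "\<forall>w\<in>sphere 0 1. norm (h w) \<le> B"
    unfolding bounded_iff by blast
  then show ?thesis
    by (intro finite_measure.integrable_const_bound[OF finite_measure_arc_length, of _ B])
      (auto intro!: AE_I2 continuous_on_measurable_arc_length assms)
qed

lemma arc_length_integral_eq:
  fixes h :: "complex \<Rightarrow> complex"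
  assumes "continuous_on (sphere 0 1) h"
  shows "((\<lambda>t. h (cis t)) has_integral (\<integral>w. h w \<partial>arc_length)) {0..2*pi}"
proof -
  define B where "B = distr (restrict_space lborel {0..<2*pi}) (restrict_space borel (sphere 0 1)) cis"
  have h: "h \<in> borel_measurable B"
    using borel_measurable_continuous_on_restrict[OF assms] by (simp add: B_def)
  have c: "continuous_on {0..2*pi} (\<lambda>t. h (cis t))"
    by (rule continuous_on_compose2[OF assms]) (auto intro!: continuous_intros)
  have "(\<integral>w. h w \<partial>arc_length) = (\<integral>w. h w \<partial>B)"
    unfolding arc_length_def B_def[symmetric] by (rule integral_completion[OF h])
  also have "\<dots> = (\<integral>t. h (cis t) \<partial>restrict_space lborel {0..<2*pi})"
    unfolding B_def
    by (rule integral_distr[OF cis_measurable_arc]) (use h in \<open>simp add: B_def\<close>)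
  also have "\<dots> = (LINT t:{0..<2*pi}|lborel. h (cis t))"
    by (simp add: integral_restrict_space set_lebesgue_integral_def)
  \<comment> \<open>The half-open interval makes \<open>cis\<close> hit each point of the circle
    once; the added endpoint is a null set.\<close>
  also have "\<dots> = (LINT t:{0..2*pi}|lborel. h (cis t))"
    unfolding set_lebesgue_integral_def
  proof (rule integral_cong_AE)
    show "AE t in lborel. indicator {0..<2*pi} t *\<^sub>R h (cis t) = indicator {0..2*pi} t *\<^sub>R h (cis t)"
      using AE_lborel_singleton[of "2*pi"] by eventually_elim (auto simp: indicator_def)
  qed (use c in \<open>auto intro!: borel_measurable_continuous_on_indicator
      intro: continuous_on_subset[of "{0..2*pi}"]\<close>)
  also have "\<dots> = integral {0..2*pi} (\<lambda>t. h (cis t))"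
    by (intro set_borel_integral_eq_integral borel_integrable_atLeastAtMost') (rule c)
  finally show ?thesis
    using integrable_continuous_real[OF c] by (simp add: has_integral_integral)
qed

text \<open>Along w = cis t the contour differential is \<i> * w dt, hence the extra factor w and
  the division by \<i>.\<close>

lemma arc_length_contour_integral:
  assumes "continuous_on (sphere 0 1) g" "(g has_contour_integral I) (circlepath 0 1)"
  shows "(\<integral>w. g w * w \<partial>arc_length) = I / \<i>"
proof -
  have "((\<lambda>t. g (cis t) * \<i> * cis t) has_integral I) {0..2*pi}"
    using assms(2) unfolding circlepath_def
    by (subst (asm) has_contour_integral_part_circlepath_iff) auto
  then have "((\<lambda>t. g (cis t) * \<i> * cis t / \<i>) has_integral I / \<i>) {0..2*pi}"
    by (rule has_integral_divide)
  moreover have "(\<lambda>t. g (cis t) * \<i> * cis t / \<i>) = (\<lambda>t. g (cis t) * cis t)"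
    by (simp add: mult_ac)
  ultimately have "((\<lambda>t. g (cis t) * cis t) has_integral I / \<i>) {0..2*pi}"
    by (simp only:)
  moreover have "((\<lambda>t. g (cis t) * cis t) has_integral (\<integral>w. g w * w \<partial>arc_length)) {0..2*pi}"
    by (rule arc_length_integral_eq) (intro continuous_intros assms)
  ultimately show ?thesis by (rule has_integral_unique[symmetric])
qed

section \<open>Cauchy and Poisson integrals over the circle\<close>

text \<open>On the circle cnj w = 1 / w. Thus the inverse of cnj (w - z) becomes w / (1 - cnj z *
  w), which for |z| < 1 is holomorphic on the closed disk and so admissible in Cauchy's
  formula.\<close>

lemma circle_cnj_diff:
  assumes "w \<in> sphere 0 1"
  shows "cnj (w - z) = (1 - cnj z * w) / w"
proof -
  have "w * cnj w = 1"
    using assms by (simp add: complex_norm_square[symmetric])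
  moreover from this have "w \<noteq> 0" by auto
  ultimately show ?thesis by (simp add: field_simps)
qed

lemma one_minus_cnj_mult_nonzero:
  assumes "cmod z < 1" "cmod w \<le> 1"
  shows "1 - cnj z * w \<noteq> 0"
proof
  assume "1 - cnj z * w = 0"
  then have "cmod (cnj z * w) = 1" by (metis eq_iff_diff_eq_0 norm_one)
  moreover have "cmod z * cmod w < 1"
    using assms by (metis mult_left_le norm_ge_zero order_le_less_trans)
  ultimately show False by (simp add: norm_mult)
qed

lemma Cauchy_integral_arc_length:
  fixes g :: "complex \<Rightarrow> complex"
  assumes "g holomorphic_on cball 0 1" "cmod z < 1"
  shows "(\<integral>w. g w / (w - z) * w \<partial>arc_length) = 2 * pi * g z"
proof -
  have "((\<lambda>w. g w / (w - z)) has_contour_integral (2 * pi * \<i> * g z)) (circlepath 0 1)"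
    using Cauchy_integral_circlepath_simple[OF assms(1), of z] assms(2) by simp
  moreover have "continuous_on (sphere 0 1) (\<lambda>w. g w / (w - z))"
    using assms
    by (intro continuous_intros) (auto intro: holomorphic_on_imp_continuous_on continuous_on_subset)
  ultimately show ?thesis by (subst arc_length_contour_integral) auto
qed

lemma one_minus_norm_square: "complex_of_real (1 - (cmod z)\<^sup>2) = 1 - cnj z * z"
  by (simp only: of_real_diff of_real_1 complex_norm_square mult.commute)

text \<open>By \<open>circle_cnj_diff\<close> the integrand is g w / (w - z) * w with g w = (1 -
  |z|^2) / (1 - cnj z * w), and g z = 1.\<close>

lemma Poisson_integral_arc_length:
  assumes "cmod z < 1"
  shows "(\<integral>w. (1 - (cmod z)\<^sup>2) / (cmod (w - z))\<^sup>2 \<partial>arc_length) = 2 * pi"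
proof -
  have "complex_of_real (\<integral>w. (1 - (cmod z)\<^sup>2) / (cmod (w - z))\<^sup>2 \<partial>arc_length) =
      (\<integral>w. of_real (1 - (cmod z)\<^sup>2) / (1 - cnj z * w) / (w - z) * w \<partial>arc_length)"
    unfolding integral_complex_of_real[symmetric]
  proof (intro Bochner_Integration.integral_cong refl)
    fix w assume "w \<in> space arc_length"
    then have w: "w \<in> sphere 0 1" by simp
    have "complex_of_real ((cmod (w - z))\<^sup>2) = (w - z) * ((1 - cnj z * w) / w)"
      unfolding complex_norm_square circle_cnj_diff[OF w] ..
    moreover have "w \<noteq> 0" using w by auto
    ultimately show "complex_of_real ((1 - (cmod z)\<^sup>2) / (cmod (w - z))\<^sup>2) =
        of_real (1 - (cmod z)\<^sup>2) / (1 - cnj z * w) / (w - z) * w"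
      by simp
  qed
  also have "\<dots> = 2 * pi * (of_real (1 - (cmod z)\<^sup>2) / (1 - cnj z * z))"
    by (intro Cauchy_integral_arc_length holomorphic_intros)
      (use one_minus_cnj_mult_nonzero[OF assms] assms in auto)
  also have "of_real (1 - (cmod z)\<^sup>2) = 1 - cnj z * z"
    by (rule one_minus_norm_square)
  finally show ?thesis
    using one_minus_cnj_mult_nonzero[OF assms less_imp_le[OF assms]]
    by (simp only: divide_self mult_1_right of_real_eq_iff not_False_eq_True)
qed

section \<open>Mean and modulus of the rotated kernel\<close>

text \<open>The key identity is 1 - cnj (z / w) = w * cnj (w - z). One of the three conjugate
  factors comes from the squared modulus in \<open>kernel_K\<close>, the other two from the square.
  The explicit exponents 1 and 3 match the family of inverse powers differentiated below.\<close>

lemma rotated_kernel_eq: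
  assumes "w \<in> sphere 0 1"
  shows "w * kernel_K (z * inverse w) =
    \<i> * of_real ((1 - (cmod z)\<^sup>2) ^ 3) * (cnj w * inverse (w - z) ^ 1 * cnj (inverse (w - z)) ^ 3)"
proof -
  have w: "cmod w = 1" "w \<noteq> 0" "cnj w \<noteq> 0" "inverse w = cnj w" "w * cnj w = 1"
    using assms by (auto simp: complex_norm_square[symmetric] inverse_unique)
  have 1: "1 - cnj (z * inverse w) = w * cnj (w - z)"
    using w by (simp add: algebra_simps)
  have 2: "complex_of_real ((cmod (1 - cnj (z * inverse w)))\<^sup>2) = (w - z) * cnj (w - z)"
    unfolding 1 norm_mult complex_mod_cnj w(1) mult_1 by (rule complex_norm_square)
  have 3: "w * (\<i> * c / (a * b * (w * b)\<^sup>2)) = \<i> * c * (inverse w * inverse a ^ 1 * inverse b ^ 3)"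
    for a b c :: complex
    using w(2) by (simp add: divide_inverse power2_eq_square power3_eq_cube mult_ac)
  have 4: "cmod (z * inverse w) = cmod z"
    using w(1) by (simp add: norm_mult norm_inverse)
  show ?thesis
    unfolding kernel_K_def 2 4 unfolding 1 unfolding 3 complex_cnj_inverse w(4) ..
qed

lemma norm_rotated_kernel:
  assumes "w \<in> sphere 0 1" "cmod z < 1"
  shows "cmod (w * kernel_K (z * inverse w)) = (1 - (cmod z)\<^sup>2) ^ 3 / (cmod (w - z)) ^ 4"
proof -
  have "0 \<le> 1 - (cmod z)\<^sup>2" using assms by (simp add: abs_square_le_1)
  moreover have "cmod w = 1" using assms by simp
  ultimately show ?thesis unfolding rotated_kernel_eq[OF assms(1)]
    by (simp add: norm_mult norm_power norm_inverse power_inverse divide_inverse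
        power3_eq_cube power4_eq_xxxx del: complex_cnj_diff complex_cnj_inverse of_real_power of_real_diff)
qed

lemma continuous_on_rotated_kernel:
  assumes "cmod z < 1"
  shows "continuous_on (sphere 0 1) (\<lambda>w. w * kernel_K (z * inverse w))"
proof -
  have "continuous_on (sphere 0 1) (\<lambda>w. \<i> * of_real ((1 - (cmod z)\<^sup>2) ^ 3) *
      (cnj w * inverse (w - z) ^ 1 * cnj (inverse (w - z)) ^ 3))"
    using assms by (intro continuous_intros) auto
  then show ?thesis
    by (rule continuous_on_eq) (simp only: rotated_kernel_eq)
qed

text \<open>Cauchy's formula is applied to \<i> * (1 - |z|^2)^3 * w / (1 - cnj z * w)^3, whose cubes
  cancel at w = z. Hence the convolution sends the constant 1 to
  \<open>rotation_field\<close>.\<close>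

lemma rotated_kernel_mean:
  assumes "cmod z < 1"
  shows "(\<integral>w. w * kernel_K (z * inverse w) \<partial>arc_length) = 2 * pi * (\<i> * z)"
proof -
  let ?c = "complex_of_real ((1 - (cmod z)\<^sup>2) ^ 3)"
  have "(\<integral>w. w * kernel_K (z * inverse w) \<partial>arc_length) =
      (\<integral>w. \<i> * ?c * w / (1 - cnj z * w) ^ 3 / (w - z) * w \<partial>arc_length)"
  proof (intro Bochner_Integration.integral_cong refl)
    fix w assume "w \<in> space arc_length"
    then have w: "w \<in> sphere 0 1" by simp
    then have "w \<noteq> 0" and "w * cnj w = 1"
      by (auto simp: complex_norm_square[symmetric])
    then have "cnj w = inverse w" by (simp add: inverse_unique)
    note w' = \<open>w \<noteq> 0\<close> this
    show "w * kernel_K (z * inverse w) = \<i> * ?c * w / (1 - cnj z * w) ^ 3 / (w - z) * w"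
      unfolding rotated_kernel_eq[OF w] complex_cnj_inverse circle_cnj_diff[OF w]
      using w' by (simp add: divide_inverse power3_eq_cube mult_ac)
  qed
  also have "\<dots> = 2 * pi * (\<i> * ?c * z / (1 - cnj z * z) ^ 3)"
    by (intro Cauchy_integral_arc_length holomorphic_intros)
      (use one_minus_cnj_mult_nonzero[OF assms] assms in auto)
  also have "?c = (1 - cnj z * z) ^ 3"
    by (simp only: of_real_power one_minus_norm_square)
  finally show ?thesis
    using one_minus_cnj_mult_nonzero[OF assms less_imp_le[OF assms]] by simp
qed

lemma rotated_kernel_norm_integral:
  assumes "cmod z < 1"
  shows "(\<integral>w. cmod (w * kernel_K (z * inverse w)) \<partial>arc_length) \<le> 8 * pi"
proof -
  have "(\<integral>w. cmod (w * kernel_K (z * inverse w)) \<partial>arc_length) \<le>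
      (\<integral>w. 4 * ((1 - (cmod z)\<^sup>2) / (cmod (w - z))\<^sup>2) \<partial>arc_length)"
  proof (intro integral_mono continuous_on_integrable_arc_length continuous_on_norm
      continuous_on_rotated_kernel assms)
    show "continuous_on (sphere 0 1) (\<lambda>w. 4 * ((1 - (cmod z)\<^sup>2) / (cmod (w - z))\<^sup>2))"
      using assms by (intro continuous_intros) auto
    fix w assume "w \<in> space arc_length"
    then have w: "w \<in> sphere 0 1" by simp
    let ?r = "cmod z" and ?d = "cmod (w - z)"
    have d: "1 - ?r \<le> ?d" using norm_triangle_ineq2[of w z] w by simp
    have "(1 - ?r\<^sup>2)\<^sup>2 = (1 + ?r)\<^sup>2 * (1 - ?r)\<^sup>2"
      by (simp add: power_mult_distrib[symmetric] algebra_simps power2_eq_square)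
    also have "\<dots> \<le> 2\<^sup>2 * ?d\<^sup>2"
      using assms d by (intro mult_mono power_mono) auto
    finally have "(1 - ?r\<^sup>2)\<^sup>2 / ?d\<^sup>2 \<le> 4"
      using d assms by (simp add: divide_simps)
    then have "(1 - ?r\<^sup>2)\<^sup>2 / ?d\<^sup>2 * ((1 - ?r\<^sup>2) / ?d\<^sup>2) \<le> 4 * ((1 - ?r\<^sup>2) / ?d\<^sup>2)"
      using assms by (intro mult_right_mono) (auto simp: abs_square_le_1)
    then show "cmod (w * kernel_K (z * inverse w)) \<le> 4 * ((1 - ?r\<^sup>2) / ?d\<^sup>2)"
      unfolding norm_rotated_kernel[OF w assms]
      by (simp add: power2_eq_square power3_eq_cube power4_eq_xxxx mult_ac)
  qed
  also have "\<dots> = 8 * pi"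
    using Poisson_integral_arc_length[OF assms]
    by (subst integral_mult_right_zero) simp
  finally show ?thesis .
qed

lemma integrable_mult_continuous_arc_length:
  fixes h g :: "complex \<Rightarrow> complex"
  assumes "integrable arc_length h" "continuous_on (sphere 0 1) g"
  shows "integrable arc_length (\<lambda>w. h w * g w)"
proof -
  have "bounded (g ` sphere 0 1)"
    by (intro compact_imp_bounded compact_continuous_image assms) simp
  then obtain B where B: "\<And>w. w \<in> sphere 0 1 \<Longrightarrow> norm (g w) \<le> B"
    unfolding bounded_iff by blast
  have [measurable]: "h \<in> borel_measurable arc_length" "g \<in> borel_measurable arc_length"
    using assms continuous_on_measurable_arc_length by auto
  show ?thesis
  proof (rule Bochner_Integration.integrable_bound)
    show "integrable arc_length (\<lambda>w. h w * of_real B)" using assms(1) by simp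
    show "AE w in arc_length. norm (h w * g w) \<le> norm (h w * of_real B)"
      using B by (intro AE_I2) (auto simp: norm_mult intro!: mult_left_mono order_trans[OF B abs_ge_self])
  qed measurable
qed

section \<open>Smoothness of the convolution\<close>

text \<open>The two summands are the Wirtinger derivatives: the one in z raises \<open>a\<close>,
  the one in cnj z raises \<open>b\<close>, so the derivative stays in the same family.\<close>

lemma has_derivative_inverse_powers:
  fixes w z :: complex
  assumes "w \<noteq> z"
  shows "((\<lambda>z. inverse (w - z) ^ a * cnj (inverse (w - z)) ^ b) has_derivative
    (\<lambda>v. of_nat a * v * (inverse (w - z) ^ Suc a * cnj (inverse (w - z)) ^ b) +
      of_nat b * cnj v * (inverse (w - z) ^ a * cnj (inverse (w - z)) ^ Suc b))) (at z)"
proof -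
  have d: "((\<lambda>z. inverse (w - z)) has_derivative (\<lambda>v. v * (inverse (w - z))\<^sup>2)) (at z)"
    using assms by (auto intro!: derivative_eq_intros simp: power2_eq_square)
  have e: "((\<lambda>z. cnj (inverse (w - z))) has_derivative (\<lambda>v. cnj (v * (inverse (w - z))\<^sup>2))) (at z)"
    by (rule bounded_linear.has_derivative[OF bounded_linear_cnj d])
  \<comment> \<open>The power rule produces the truncated exponent n - 1; for n = 0 the factor
    \<open>of_nat n\<close> makes both sides vanish.\<close>
  have p: "of_nat n * (v * q\<^sup>2) * q ^ (n - 1) = of_nat n * v * q ^ Suc n" for n and v q :: complex
    by (cases n) (auto simp: power2_eq_square)
  show ?thesis
    by (rule has_derivative_eq_rhs[OF has_derivative_mult[OF has_derivative_power[OF d] has_derivative_power[OF e]]])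
      (simp only: complex_cnj_mult complex_cnj_power p, simp add: algebra_simps)
qed

text \<open>The induction on k runs over all exponents at once, because each derivative raises one
  of them.\<close>

lemma Ck_on_integral_inverse_powers:
  fixes h :: "complex \<Rightarrow> complex"
  assumes h: "integrable arc_length h"
  shows "Ck_on k (ball 0 1)
    (\<lambda>z. \<integral>w. h w * (inverse (w - z) ^ a * cnj (inverse (w - z)) ^ b) \<partial>arc_length)"
proof (induction k arbitrary: a b)
  let ?J = "\<lambda>a b z. \<integral>w. h w * (inverse (w - z) ^ a * cnj (inverse (w - z)) ^ b) \<partial>arc_length"
  let ?D = "\<lambda>a b z v. of_nat a * v * ?J (Suc a) b z + of_nat b * cnj v * ?J a (Suc b) z"
  have D: "(?J a b has_derivative ?D a b z) (at z)" if z: "z \<in> ball 0 1" for a b z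
  proof -
    \<comment> \<open>Domination needs distance from the circle: for |y| < \<rho> and |w| = 1 one
      has |w - y| \<ge> 1 - \<rho>, so all inverses are bounded by \<open>c\<close>.\<close>
    obtain \<rho> where \<rho>: "cmod z < \<rho>" "\<rho> < 1" using dense[of "cmod z" 1] z by auto
    define c where "c = inverse (1 - \<rho>)"
    have ne: "w \<noteq> y" if "y \<in> ball 0 \<rho>" "w \<in> sphere 0 1" for w y
      using that \<rho> by auto
    have c: "cmod (inverse (w - y)) \<le> c" if "y \<in> ball 0 \<rho>" "w \<in> sphere 0 1" for w y
    proof -
      have "1 - \<rho> \<le> cmod (w - y)" using norm_triangle_ineq2[of w y] that by simp
      then show ?thesis unfolding c_def norm_inverse using \<rho> by (intro le_imp_inverse_le) auto
    qed
    have c_pos: "0 < c" using \<rho> by (simp add: c_def)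
    define D where "D y w v = h w * (of_nat a * v * (inverse (w - y) ^ Suc a * cnj (inverse (w - y)) ^ b) +
      of_nat b * cnj v * (inverse (w - y) ^ a * cnj (inverse (w - y)) ^ Suc b))" for y w v
    have int: "integrable arc_length (\<lambda>w. h w * (inverse (w - y) ^ a * cnj (inverse (w - y)) ^ b))"
      if "y \<in> ball 0 \<rho>" for a b y
      using ne[OF that] by (intro integrable_mult_continuous_arc_length h continuous_intros) auto
    have z\<rho>: "z \<in> ball 0 \<rho>" using \<rho> by simp
    have D_eq: "D y w v = of_nat a * v * (h w * (inverse (w - y) ^ Suc a * cnj (inverse (w - y)) ^ b)) +
      of_nat b * cnj v * (h w * (inverse (w - y) ^ a * cnj (inverse (w - y)) ^ Suc b))" for y w v
      unfolding D_def by (simp only: distrib_left mult_ac)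
    have "(?J a b has_derivative (\<lambda>v. \<integral>w. D z w v \<partial>arc_length)) (at z)"
    proof (rule has_derivative_integral[where S = "ball 0 \<rho>" and D = D and
        B = "\<lambda>w. cmod (h w) * (real (a + b) * c ^ Suc (a + b))"])
      fix y w :: complex assume y: "y \<in> ball 0 \<rho>" and "w \<in> space arc_length"
      then have w: "w \<in> sphere 0 1" by simp
      show "((\<lambda>y. h w * (inverse (w - y) ^ a * cnj (inverse (w - y)) ^ b)) has_derivative D y w) (at y)"
        unfolding D_def[abs_def]
        by (intro has_derivative_mult_right has_derivative_inverse_powers ne[OF y w])
      have pc: "cmod (inverse (w - y) ^ m * cnj (inverse (w - y)) ^ n) \<le> c ^ (m + n)" for m n
        unfolding norm_mult norm_power complex_mod_cnj power_add[symmetric]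
        by (intro power_mono c y w) simp
      have "cmod (D y w v) \<le> cmod (h w) * (real (a + b) * c ^ Suc (a + b)) * cmod v" for v
      proof -
        have "cmod (of_nat a * v * (inverse (w - y) ^ Suc a * cnj (inverse (w - y)) ^ b) +
            of_nat b * cnj v * (inverse (w - y) ^ a * cnj (inverse (w - y)) ^ Suc b)) \<le>
          real a * cmod v * c ^ (Suc a + b) + real b * cmod v * c ^ (a + Suc b)"
          by (rule order_trans[OF norm_triangle_ineq], unfold norm_mult[of "of_nat _ * _"])
            (intro add_mono mult_mono pc; simp add: norm_mult c_pos less_imp_le)
        then have "cmod (h w) * cmod (of_nat a * v * (inverse (w - y) ^ Suc a * cnj (inverse (w - y)) ^ b) +
            of_nat b * cnj v * (inverse (w - y) ^ a * cnj (inverse (w - y)) ^ Suc b)) \<le>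
          cmod (h w) * (real a * cmod v * c ^ (Suc a + b) + real b * cmod v * c ^ (a + Suc b))"
          by (rule mult_left_mono) simp
        then show ?thesis unfolding D_def norm_mult[of "h w"] by (simp add: algebra_simps)
      qed
      then show "onorm (D y w) \<le> cmod (h w) * (real (a + b) * c ^ Suc (a + b))"
        by (rule onorm_le)
    next
      show "(\<lambda>w. D z w v) \<in> borel_measurable arc_length" for v
        unfolding D_eq
        by (intro borel_measurable_integrable Bochner_Integration.integrable_add integrable_mult_right int z\<rho>)
      show "integrable arc_length (\<lambda>w. cmod (h w) * (real (a + b) * c ^ Suc (a + b)))"
        by (intro integrable_mult_left integrable_norm h)
    qed (use z\<rho> int in auto)
    moreover have "(\<integral>w. D z w v \<partial>arc_length) = ?D a b z v" for v
      unfolding D_eq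
      by (simp only: Bochner_Integration.integral_add integrable_mult_right int z\<rho>
          integral_mult_right_zero)
    ultimately show ?thesis by (simp only:)
  qed
  case 0
  show ?case
    unfolding Ck_on.simps(1)
    by (intro continuous_at_imp_continuous_on ballI has_derivative_continuous[OF D])
  case (Suc k)
  show ?case
    by (rule Ck_on_SucI[OF open_ball D], assumption)
      (intro Ck_on_add Ck_on_mult Ck_on_const open_ball Suc.IH)
qed

text \<open>Separates the numerator, written as a polynomial in z and cnj z, from an integral
  covered by \<open>Ck_on_integral_inverse_powers\<close> with h w = f w * cnj w.\<close>

lemma circle_convolution_kernel_eq:
  "circle_convolution f kernel_K z = of_real (1 / (2 * pi)) * \<i> * (1 - cnj z * z) ^ 3 *
    (\<integral>w. (of_real (f w) * cnj w) * (inverse (w - z) ^ 1 * cnj (inverse (w - z)) ^ 3) \<partial>arc_length)"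
proof -
  have "(\<integral>w. of_real (f w) * w * kernel_K (z * inverse w) \<partial>arc_length) =
      (\<integral>w. \<i> * (1 - cnj z * z) ^ 3 *
        ((of_real (f w) * cnj w) * (inverse (w - z) ^ 1 * cnj (inverse (w - z)) ^ 3)) \<partial>arc_length)"
  proof (intro Bochner_Integration.integral_cong refl)
    fix w assume "w \<in> space arc_length"
    then have "w \<in> sphere 0 1" by simp
    note eq = rotated_kernel_eq[OF this, of z, unfolded of_real_power one_minus_norm_square]
    show "of_real (f w) * w * kernel_K (z * inverse w) = \<i> * (1 - cnj z * z) ^ 3 *
        ((of_real (f w) * cnj w) * (inverse (w - z) ^ 1 * cnj (inverse (w - z)) ^ 3))"
      unfolding mult.assoc[of "of_real (f w)"] eq by (simp only: mult_ac)
  qed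
  then show ?thesis
    unfolding circle_convolution_def by (simp only: integral_mult_right_zero mult.assoc)
qed

lemma smooth_on_circle_convolution:
  assumes "integrable arc_length f"
  shows "smooth_on (ball 0 1) (circle_convolution f kernel_K)"
  unfolding smooth_on_def
proof
  fix k
  have "integrable arc_length (\<lambda>w. of_real (f w) * cnj w)"
    using assms by (intro integrable_mult_continuous_arc_length continuous_intros) simp
  then have J: "Ck_on k (ball 0 1) (\<lambda>z. \<integral>w. (of_real (f w) * cnj w) *
      (inverse (w - z) ^ 1 * cnj (inverse (w - z)) ^ 3) \<partial>arc_length)"
    by (rule Ck_on_integral_inverse_powers)
  have "Ck_on k (ball 0 1) (\<lambda>z :: complex. 1 + (- 1) * (cnj z * z))"
    by (intro Ck_on_add Ck_on_mult Ck_on_const open_ball Ck_on_bounded_linear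
        bounded_linear_cnj bounded_linear_ident)
  then have "Ck_on k (ball 0 1) (\<lambda>z :: complex. 1 - cnj z * z)" by simp
  then show "Ck_on k (ball 0 1) (circle_convolution f kernel_K)"
    unfolding circle_convolution_kernel_eq[abs_def]
    by (intro Ck_on_mult Ck_on_power Ck_on_const open_ball J)
qed

section \<open>Uniform boundedness of the dilated convolutions in the mean square\<close>

lemma square_integrable_arc_length_integrable:
  fixes f :: "complex \<Rightarrow> real"
  assumes "square_integrable arc_length f"
  shows "integrable arc_length f"
  using finite_measure.square_integrable_imp_integrable[OF finite_measure_arc_length] assms
  by (auto simp: square_integrable_def)

lemma integrable_circle_convolution:
  fixes f :: "complex \<Rightarrow> real"
  assumes "integrable arc_length f" "cmod z < 1"
  shows "integrable arc_length (\<lambda>w. of_real (f w) * w * kernel_K (z * inverse w))"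
proof -
  have "integrable arc_length (\<lambda>w. complex_of_real (f w) * (w * kernel_K (z * inverse w)))"
    using assms
    by (intro integrable_mult_continuous_arc_length continuous_on_rotated_kernel) simp_all
  then show ?thesis by (simp only: mult.assoc)
qed

lemma circle_convolution_diff:
  fixes f g :: "complex \<Rightarrow> real"
  assumes "integrable arc_length f" "integrable arc_length g" "cmod z < 1"
  shows "circle_convolution (\<lambda>w. f w - g w) kernel_K z =
    circle_convolution f kernel_K z - circle_convolution g kernel_K z"
  unfolding circle_convolution_def of_real_diff left_diff_distrib right_diff_distrib[symmetric]
  by (simp only: Bochner_Integration.integral_diff integrable_circle_convolution assms)

lemma kernel_K_borel_measurable [measurable]: "kernel_K \<in> borel_measurable borel"
proof -
  have [measurable]: "cnj \<in> borel_measurable borel"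
    by (intro borel_measurable_continuous_onI continuous_intros)
  show ?thesis unfolding kernel_K_def[abs_def] by measurable
qed

text \<open>For unit z and w, z * w * cnj (z - r w) = w - r z, so both distances agree. This turns
  the row bound of Schur's test into the column bound.\<close>

lemma norm_rotated_kernel_swap:
  assumes "z \<in> sphere 0 1" "w \<in> sphere 0 1" "0 \<le> r" "r < 1"
  shows "cmod (w * kernel_K (of_real r * z * inverse w)) = cmod (z * kernel_K (of_real r * w * inverse z))"
proof -
  have "cmod (z * w * cnj (z - of_real r * w)) = cmod (z - of_real r * w)"
    unfolding norm_mult complex_mod_cnj using assms by simp
  moreover have "z * cnj z = 1" "w * cnj w = 1"
    using assms by (auto simp: complex_norm_square[symmetric])
  then have "z * w * cnj (z - of_real r * w) = w - of_real r * z"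
    by (simp add: right_diff_distrib) (simp add: mult_ac)
  ultimately have "cmod (w - of_real r * z) = cmod (z - of_real r * w)" by simp
  moreover have "cmod (of_real r * z) = r" "cmod (of_real r * w) = r"
    using assms by (auto simp: norm_mult)
  ultimately show ?thesis
    using assms by (simp only: norm_rotated_kernel)
qed

text \<open>The constant does not depend on r, so the error of replacing f by a Lipschitz function
  is controlled before r tends to 1.\<close>

lemma circle_convolution_L2_bound:
  assumes f: "square_integrable arc_length f" and r: "0 \<le> r" "r < 1"
  shows "integrable arc_length (\<lambda>z. (cmod (circle_convolution f kernel_K (of_real r * z)))\<^sup>2)"
    and "(\<integral>z. (cmod (circle_convolution f kernel_K (of_real r * z)))\<^sup>2 \<partial>arc_length) \<le>
      16 * (\<integral>w. (f w)\<^sup>2 \<partial>arc_length)"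
proof -
  interpret finite_measure arc_length by (rule finite_measure_arc_length)
  have f_meas [measurable]: "f \<in> borel_measurable arc_length" and f2: "integrable arc_length (\<lambda>w. (f w)\<^sup>2)"
    using f by (auto simp: square_integrable_def)
  \<comment> \<open>The normalization by 2 * pi is put into \<open>k\<close>, which turns the bound
    8 * pi into the row bound 4.\<close>
  define k where "k z w = cmod (w * kernel_K (of_real r * z * inverse w)) / (2 * pi)" for z w
  note [measurable] = ident_measurable_arc_length
  have row: "(\<integral>\<^sup>+w. ennreal (k z w) \<partial>arc_length) \<le> 4" if "z \<in> sphere 0 1" for z
  proof -
    have rz: "cmod (of_real r * z) < 1" using that r by (simp add: norm_mult)
    have i: "integrable arc_length (k z)" unfolding k_def[abs_def] using rz
      by (intro continuous_on_integrable_arc_length continuous_intros continuous_on_rotated_kernel) auto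
    have "(\<integral>w. k z w \<partial>arc_length) \<le> 4"
      using rotated_kernel_norm_integral[OF rz] by (simp add: k_def field_simps)
    then show ?thesis
      using nn_integral_eq_integral[OF i] by (simp add: k_def[abs_def] ennreal_le_iff[symmetric])
  qed
  have pointwise: "ennreal (cmod (circle_convolution f kernel_K (of_real r * z))) \<le>
      (\<integral>\<^sup>+w. ennreal (k z w) * ennreal \<bar>f w\<bar> \<partial>arc_length)" if z: "z \<in> sphere 0 1" for z
  proof -
    have i: "integrable arc_length (\<lambda>w. k z w * \<bar>f w\<bar>)"
      using integrable_norm[OF integrable_circle_convolution[OF square_integrable_arc_length_integrable[OF f], of "of_real r * z"]] z r
      by (simp add: k_def norm_mult mult_ac)
    have "cmod (circle_convolution f kernel_K (of_real r * z)) \<le>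
        1 / (2 * pi) * (\<integral>w. cmod (complex_of_real (f w) * w * kernel_K (of_real r * z * inverse w)) \<partial>arc_length)"
      unfolding circle_convolution_def norm_mult[of "of_real _"] norm_of_real
      using integral_norm_bound by (intro mult_mono) auto
    also have "\<dots> = (\<integral>w. k z w * \<bar>f w\<bar> \<partial>arc_length)"
      by (subst integral_mult_right_zero[symmetric]) (simp add: k_def norm_mult mult_ac)
    finally have "ennreal (cmod (circle_convolution f kernel_K (of_real r * z))) \<le>
        ennreal (\<integral>w. k z w * \<bar>f w\<bar> \<partial>arc_length)"
      by (rule ennreal_leI)
    also have "\<dots> = (\<integral>\<^sup>+w. ennreal (k z w * \<bar>f w\<bar>) \<partial>arc_length)"
      by (rule nn_integral_eq_integral[OF i, symmetric]) (simp add: k_def)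
    also have "\<dots> = (\<integral>\<^sup>+w. ennreal (k z w) * ennreal \<bar>f w\<bar> \<partial>arc_length)"
      by (intro nn_integral_cong ennreal_mult) (simp_all add: k_def)
    finally show ?thesis .
  qed
  have "(\<integral>\<^sup>+z. ennreal ((cmod (circle_convolution f kernel_K (of_real r * z)))\<^sup>2) \<partial>arc_length) \<le>
      (\<integral>\<^sup>+z. (\<integral>\<^sup>+w. ennreal (k z w) * ennreal \<bar>f w\<bar> \<partial>arc_length)\<^sup>2 \<partial>arc_length)"
    by (intro nn_integral_mono) (simp add: ennreal_power[symmetric] power_mono pointwise)
  also have "\<dots> \<le> 4 * 4 * (\<integral>\<^sup>+w. (ennreal \<bar>f w\<bar>)\<^sup>2 \<partial>arc_length)"
  proof (rule Schur_test)
    show "case_prod k \<in> borel_measurable (arc_length \<Otimes>\<^sub>M arc_length)"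
      unfolding k_def[abs_def] by measurable
    show "(\<integral>\<^sup>+z. ennreal (k z w) \<partial>arc_length) \<le> 4" if "w \<in> space arc_length" for w
    proof -
      have "(\<integral>\<^sup>+z. ennreal (k z w) \<partial>arc_length) = (\<integral>\<^sup>+z. ennreal (k w z) \<partial>arc_length)"
        using that r by (intro nn_integral_cong) (simp add: k_def norm_rotated_kernel_swap)
      then show ?thesis using row[of w] that by simp
    qed
  qed (use row in \<open>auto simp: k_def sigma_finite_measure_axioms\<close>)
  also have "(\<integral>\<^sup>+w. (ennreal \<bar>f w\<bar>)\<^sup>2 \<partial>arc_length) = ennreal (\<integral>w. (f w)\<^sup>2 \<partial>arc_length)"
    using nn_integral_eq_integral[OF f2] by (simp add: ennreal_power)
  also have "4 * 4 * \<dots> = ennreal (16 * (\<integral>w. (f w)\<^sup>2 \<partial>arc_length))"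
    by (simp add: ennreal_mult)
  finally have le: "(\<integral>\<^sup>+z. ennreal ((cmod (circle_convolution f kernel_K (of_real r * z)))\<^sup>2) \<partial>arc_length) \<le>
      ennreal (16 * (\<integral>w. (f w)\<^sup>2 \<partial>arc_length))" .
  have "continuous_on (ball 0 1) (circle_convolution f kernel_K)"
    using smooth_on_circle_convolution[OF square_integrable_arc_length_integrable[OF f]]
    by (metis smooth_on_def Ck_on.simps(1))
  then have "continuous_on (sphere 0 1) (\<lambda>z. circle_convolution f kernel_K (of_real r * z))"
    by (rule continuous_on_compose2) (use r in \<open>auto intro!: continuous_intros simp: norm_mult\<close>)
  then show *: "integrable arc_length (\<lambda>z. (cmod (circle_convolution f kernel_K (of_real r * z)))\<^sup>2)"
    by (intro continuous_on_integrable_arc_length continuous_intros)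
  show "(\<integral>z. (cmod (circle_convolution f kernel_K (of_real r * z)))\<^sup>2 \<partial>arc_length) \<le>
      16 * (\<integral>w. (f w)\<^sup>2 \<partial>arc_length)"
    using le by (subst (asm) nn_integral_eq_integral[OF *]) (auto simp: ennreal_le_iff)
qed

section \<open>Boundary values\<close>

text \<open>By \<open>rotated_kernel_mean\<close> at r z, the subtracted term, including its factor
  r, is exactly the convolution of the constant g z. Only g w - g z remains under the integral, and
  it is at most L |w - z|.\<close>

lemma circle_convolution_Lipschitz:
  fixes g :: "complex \<Rightarrow> real"
  assumes g: "L-lipschitz_on UNIV g" and z: "z \<in> sphere 0 1" and r: "0 \<le> r" "r < 1"
  shows "cmod (circle_convolution g kernel_K (of_real r * z) - of_real r * (of_real (g z) * rotation_field z)) \<le>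
    20 * L * sqrt (1 - r\<^sup>2)"
proof -
  let ?k = "\<lambda>w. w * kernel_K (of_real r * z * inverse w)"
  have rz: "cmod (of_real r * z) = r" using z r by (simp add: norm_mult)
  then have rz1: "cmod (of_real r * z) < 1" using r by simp
  have L: "0 \<le> L" by (rule lipschitz_on_nonneg[OF g])
  have gc: "continuous_on (sphere 0 1) g"
    using lipschitz_on_continuous_on[OF g] continuous_on_subset by blast
  note kc = continuous_on_rotated_kernel[OF rz1]
  \<comment> \<open>In terms of this scale the rotated kernel has modulus s^6 / |w - r z|^4. The
    weight |w - z| is traded for a factor s and a remainder 16 * s^3, both vanishing as r tends to
    1.\<close>
  define s where "s = sqrt (1 - r\<^sup>2)"
  have "r\<^sup>2 < 1" using r by (simp add: abs_square_less_1)
  then have s: "0 < s" "s \<le> 1" "s\<^sup>2 = 1 - r\<^sup>2" by (auto simp: s_def)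
  have "(\<integral>w. of_real (g w - g z) * ?k w \<partial>arc_length) =
      (\<integral>w. of_real (g w) * ?k w - of_real (g z) * ?k w \<partial>arc_length)"
    by (simp only: of_real_diff left_diff_distrib)
  also have "\<dots> = (\<integral>w. of_real (g w) * ?k w \<partial>arc_length) - of_real (g z) * (\<integral>w. ?k w \<partial>arc_length)"
    by (subst Bochner_Integration.integral_diff)
      (auto intro!: continuous_on_integrable_arc_length continuous_intros gc kc)
  finally have "circle_convolution g kernel_K (of_real r * z) - of_real r * (of_real (g z) * rotation_field z) =
      of_real (1 / (2 * pi)) * (\<integral>w. of_real (g w - g z) * ?k w \<partial>arc_length)"
    unfolding rotated_kernel_mean[OF rz1]
    by (simp add: circle_convolution_def rotation_field_def mult.assoc field_simps)
  also have "cmod \<dots> \<le> 1 / (2 * pi) * (\<integral>w. cmod (of_real (g w - g z) * ?k w) \<partial>arc_length)"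
    unfolding norm_mult[of "of_real (1 / (2 * pi))"] norm_of_real
    using integral_norm_bound by (intro mult_mono) auto
  also have "\<dots> \<le> 1 / (2 * pi) * (\<integral>w. L * (s * cmod (?k w) + 16 * s ^ 3) \<partial>arc_length)"
  proof (intro mult_left_mono integral_mono)
    show "integrable arc_length (\<lambda>w. cmod (of_real (g w - g z) * ?k w))"
      by (intro continuous_on_integrable_arc_length continuous_intros gc kc)
    show "integrable arc_length (\<lambda>w. L * (s * cmod (?k w) + 16 * s ^ 3))"
      by (intro continuous_on_integrable_arc_length continuous_intros kc)
    fix w assume "w \<in> space arc_length"
    then have w: "w \<in> sphere 0 1" by simp
    let ?d = "cmod (w - z)" and ?e = "cmod (w - of_real r * z)"
    \<comment> \<open>Since 1 - r \<le> |w - r z|, replacing r z by z at most doubles the distance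
      to w; the constant 16 is the fourth power of this 2.\<close>
    have "w - z = (w - of_real r * z) - of_real (1 - r) * z" by (simp add: algebra_simps)
    then have "?d \<le> ?e + cmod (of_real (1 - r) * z)" by (metis norm_triangle_ineq4)
    moreover have "cmod (of_real (1 - r) * z) = 1 - r" using z r by (simp only: norm_mult norm_of_real) simp
    moreover have e: "1 - r \<le> ?e" using norm_triangle_ineq2[of w "of_real r * z"] w rz by simp
    ultimately have de: "?d \<le> 2 * ?e" by simp
    have e0: "0 < ?e" using e r by linarith
    \<comment> \<open>The term \<open>?d ^ 4\<close> cancels the singularity of the kernel, so no splitting of the circle is needed.\<close>
    have "?d * s ^ 3 \<le> s * s ^ 3 + ?d ^ 4"
    proof (cases "?d \<le> s")
      case True
      then show ?thesis using s by (intro order_trans[OF mult_right_mono[OF True]]) auto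
    next
      case False
      then have "?d * s ^ 3 \<le> ?d * ?d ^ 3" using s by (intro mult_left_mono power_mono) auto
      moreover have "?d * ?d ^ 3 = ?d ^ 4" by (simp add: power4_eq_xxxx power3_eq_cube mult.assoc)
      moreover have "0 \<le> s * s ^ 3" using s by simp
      ultimately show ?thesis by linarith
    qed
    also have "?d ^ 4 \<le> (2 * ?e) ^ 4" by (intro power_mono de) simp
    finally have "?d * s ^ 3 * (s ^ 3 / ?e ^ 4) \<le> (s * s ^ 3 + (2 * ?e) ^ 4) * (s ^ 3 / ?e ^ 4)"
      using s e0 by (intro mult_right_mono) auto
    also have "\<dots> = (s * (s ^ 6 / ?e ^ 4) + 16 * s ^ 3)"
      using e0 by (simp add: field_simps power_add[symmetric])
    finally have "?d * (s ^ 6 / ?e ^ 4) \<le> s * (s ^ 6 / ?e ^ 4) + 16 * s ^ 3"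
      by (simp add: mult.assoc power_add[symmetric])
    moreover have "cmod (?k w) = s ^ 6 / ?e ^ 4"
      unfolding norm_rotated_kernel[OF w rz1] rz s(3)[symmetric] by (simp add: power_mult[symmetric])
    ultimately have *: "?d * cmod (?k w) \<le> s * cmod (?k w) + 16 * s ^ 3" by simp
    have "\<bar>g w - g z\<bar> \<le> L * ?d" using lipschitz_onD[OF g, of w z] by (simp add: dist_norm)
    then have "\<bar>g w - g z\<bar> * cmod (?k w) \<le> L * (?d * cmod (?k w))"
      unfolding mult.assoc[symmetric] by (rule mult_right_mono) simp
    also have "\<dots> \<le> L * (s * cmod (?k w) + 16 * s ^ 3)"
      by (rule mult_left_mono[OF * L])
    finally show "cmod (of_real (g w - g z) * ?k w) \<le> L * (s * cmod (?k w) + 16 * s ^ 3)"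
      unfolding norm_mult[of "of_real _"] norm_of_real .
  qed simp
  also have "\<dots> = 1 / (2 * pi) *
      (L * (s * (\<integral>w. cmod (?k w) \<partial>arc_length) + 16 * s ^ 3 * (2 * pi)))"
  proof -
    have "measure arc_length (sphere 0 1) = 2 * pi"
      by (simp add: measure_def emeasure_arc_length)
    moreover have "integrable arc_length (\<lambda>w. s * cmod (?k w))" "integrable arc_length (\<lambda>w. 16 * s ^ 3)"
      by (intro continuous_on_integrable_arc_length continuous_intros kc)+
    ultimately show ?thesis by simp
  qed
  \<comment> \<open>As s \<le> 1, s^3 may be replaced by s; then (8 * pi + 32 * pi) / (2 * pi) =
    20.\<close>
  also have "\<dots> \<le> 1 / (2 * pi) * (L * (s * (8 * pi) + 16 * s * (2 * pi)))"
  proof -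
    have "s ^ 3 \<le> s" using s power_decreasing[of 1 3 s] by simp
    then show ?thesis
      using rotated_kernel_norm_integral[OF rz1] s L
      by (intro mult_left_mono add_mono mult_right_mono) auto
  qed
  also have "\<dots> = 20 * L * s" by (simp add: field_simps)
  finally show ?thesis unfolding s_def .
qed

text \<open>A function measurable for the completion agrees almost everywhere with a Borel one,
  whose extension \<open>F\<close> by zero is Borel on the plane. For Borel g the squared distances
  of f and of \<open>F\<close> to g agree under the two measures, so approximants of
  \<open>F\<close> serve f.\<close>

lemma Lipschitz_dense_L2_arc_length:
  assumes "square_integrable arc_length f"
  shows "Lipschitz_approximable arc_length f"
proof -
  define B where "B = distr (restrict_space lborel {0..<2*pi}) (restrict_space borel (sphere 0 1)) cis"
  have arc: "arc_length = completion B" by (simp add: arc_length_def B_def)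
  have sets_B [measurable_cong]: "sets B = sets (restrict_space borel (sphere 0 1))" by (simp add: B_def)
  have space_B: "space B = sphere 0 1" by (simp add: B_def space_restrict_space)
  have f: "f \<in> borel_measurable (completion B)" "integrable (completion B) (\<lambda>w. (f w)\<^sup>2)"
    using assms by (auto simp: square_integrable_def arc)
  obtain f' where f': "f' \<in> borel_measurable B" and ae: "AE w in B. f w = f' w"
    using completion_ex_borel_measurable_real[OF f(1)] by blast
  \<comment> \<open>Regularity is available only for Borel measures on a complete space, so the uncompleted measure
    is moved to the whole plane.\<close>
  define N where "N = distr B borel (\<lambda>w. w)"
  have id: "(\<lambda>w. w) \<in> B \<rightarrow>\<^sub>M borel"
    using measurable_ident_sets[OF sets_B] measurable_restrict_space1[OF measurable_ident_sets[OF refl]]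
    by (auto simp: measurable_cong_sets[OF sets_B refl])
  define F where "F w = (if w \<in> sphere 0 1 then f' w else 0)" for w
  have "f' \<in> borel_measurable (restrict_space borel (sphere 0 1))"
    using f' by (simp add: measurable_cong_sets[OF sets_B refl])
  then have "(\<lambda>w. indicator (sphere 0 1) w *\<^sub>R f' w) \<in> borel_measurable borel"
    by (subst (asm) borel_measurable_restrict_space_iff) auto
  moreover have "(\<lambda>w. indicator (sphere 0 1) w *\<^sub>R f' w) = F"
    by (auto simp: F_def fun_eq_iff)
  ultimately have F: "F \<in> borel_measurable borel" by simp
  have finN: "finite_measure N"
  proof (rule finite_measureI)
    have "emeasure N (space N) = emeasure B (space B)"
      unfolding N_def using id by (simp add: emeasure_distr)
    also have "\<dots> = emeasure arc_length (sphere 0 1)"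
    proof -
      have "emeasure B (space B) = (\<integral>\<^sup>+ w. 1 \<partial>B)" by simp
      also have "\<dots> = (\<integral>\<^sup>+ w. 1 \<partial>arc_length)" unfolding arc nn_integral_completion ..
      also have "\<dots> = emeasure arc_length (sphere 0 1)"
        by (simp only: nn_integral_const space_arc_length mult_1)
      finally show ?thesis .
    qed
    finally show "emeasure N (space N) \<noteq> \<infinity>" by (simp add: emeasure_arc_length)
  qed
  have setsN: "sets N = sets borel" by (simp add: N_def)
  have ae': "AE w in completion B. f w = F w"
    using AE_completion[OF ae] AE_space by eventually_elim (simp add: F_def space_B)
  have transfer: "integrable arc_length (\<lambda>w. (f w - g w)\<^sup>2) \<longleftrightarrow> integrable N (\<lambda>w. (F w - g w)\<^sup>2)"
    "(\<integral>w. (f w - g w)\<^sup>2 \<partial>arc_length) = (\<integral>w. (F w - g w)\<^sup>2 \<partial>N)"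
    if g: "g \<in> borel_measurable borel" for g
  proof -
    have m: "(\<lambda>w. (F w - g w)\<^sup>2) \<in> borel_measurable borel" using F g by measurable
    note mB = measurable_compose[OF id m]
    have fm: "(\<lambda>w. (f w - g w)\<^sup>2) \<in> borel_measurable (completion B)"
      using f(1) measurable_completion[OF measurable_compose[OF id g]] by measurable
    have eq: "AE w in completion B. (f w - g w)\<^sup>2 = (F w - g w)\<^sup>2"
      using ae' by eventually_elim simp
    show "integrable arc_length (\<lambda>w. (f w - g w)\<^sup>2) \<longleftrightarrow> integrable N (\<lambda>w. (F w - g w)\<^sup>2)"
      unfolding arc N_def integrable_distr_eq[OF id m] integrable_completion[OF mB, symmetric]
      by (rule integrable_cong_AE[OF fm measurable_completion[OF mB] eq])
    show "(\<integral>w. (f w - g w)\<^sup>2 \<partial>arc_length) = (\<integral>w. (F w - g w)\<^sup>2 \<partial>N)"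
      unfolding arc N_def integral_distr[OF id m] integral_completion[OF mB, symmetric]
      by (rule integral_cong_AE[OF fm measurable_completion[OF mB] eq])
  qed
  \<comment> \<open>Taking g = 0 in \<open>transfer\<close> gives the square integrability of
    \<open>F\<close>.\<close>
  have "Lipschitz_approximable N F"
    by (rule Lipschitz_dense_L2[OF setsN finN])
      (use F f(2) transfer(1)[of "\<lambda>_. 0"] in \<open>auto simp: arc setsN cong: measurable_cong_sets\<close>)
  then show ?thesis
    unfolding Lipschitz_approximable_def using transfer Lipschitz_borel_measurable[OF _ refl]
    by metis
qed

theorem corollary4:
  fixes f :: "complex \<Rightarrow> real" and X FX :: "complex \<Rightarrow> complex"
  assumes "square_integrable arc_length f"
    and "\<And>w. w \<in> sphere 0 1 \<Longrightarrow> X w = of_real (f w) * rotation_field w"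
    and "\<And>z. z \<in> ball 0 1 \<Longrightarrow> FX z = circle_convolution f kernel_K z"
  shows "smooth_on (ball 0 1) FX \<and> L2_boundary_extension X FX"
proof -
  interpret finite_measure arc_length by (rule finite_measure_arc_length)
  note f = assms(1) and X = assms(2) and FX = assms(3)
  have f_int: "integrable arc_length f" by (rule square_integrable_arc_length_integrable[OF f])
  have fm [measurable]: "f \<in> borel_measurable arc_length" and f2: "integrable arc_length (\<lambda>w. (f w)\<^sup>2)"
    using f by (auto simp: square_integrable_def)
  note [measurable] = ident_measurable_arc_length
  have smooth: "smooth_on (ball 0 1) FX"
    unfolding smooth_on_def
  proof
    show "Ck_on k (ball 0 1) FX" for k
      by (rule Ck_on_cong[OF open_ball FX[symmetric]], assumption)
        (rule smooth_on_circle_convolution[OF f_int, unfolded smooth_on_def, THEN spec])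
  qed
  then have cont: "continuous_on (ball 0 1) FX"
    by (metis smooth_on_def Ck_on.simps(1))
  define V where "V = (\<lambda>\<epsilon> z. FX (of_real (1 - \<epsilon>) * z))"
  have V_cont: "continuous_on (sphere 0 1) (V \<epsilon>)" if "0 < \<epsilon>" "\<epsilon> < 1" for \<epsilon>
    unfolding V_def by (rule continuous_on_compose2[OF cont])
      (use that in \<open>auto intro!: continuous_intros simp: norm_mult simp del: of_real_diff\<close>)
  have Xm [measurable]: "X \<in> borel_measurable arc_length"
    by (subst measurable_cong[where g = "\<lambda>w. of_real (f w) * (\<i> * w)"])
      (auto simp: X rotation_field_def)
  have X2: "square_integrable arc_length X"
    unfolding square_integrable_def
  proof
    have "integrable arc_length (\<lambda>w. (norm (X w))\<^sup>2) \<longleftrightarrow> integrable arc_length (\<lambda>w. (f w)\<^sup>2)"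
      by (intro Bochner_Integration.integrable_cong refl) (simp add: X rotation_field_def norm_mult)
    with f2 show "integrable arc_length (\<lambda>w. (norm (X w))\<^sup>2)" by blast
  qed measurable
  have V2: "square_integrable arc_length (V \<epsilon>)" if "0 < \<epsilon>" "\<epsilon> < 1" for \<epsilon>
    unfolding square_integrable_def using V_cont[OF that]
    by (intro conjI continuous_on_measurable_arc_length continuous_on_integrable_arc_length continuous_intros)
  \<comment> \<open>This range keeps 1 - \<epsilon> nonnegative, as the estimates in r require, and
    the dilated circle inside the disk.\<close>
  have small: "\<forall>\<^sub>F \<epsilon> in at_right 0. 0 < \<epsilon> \<and> \<epsilon> < (1::real)"
    using eventually_at_right_real[of 0 1] by simp
  have "((\<lambda>\<epsilon>. \<integral>z. (cmod (V \<epsilon> z - X z))\<^sup>2 \<partial>arc_length) \<longlongrightarrow> 0) (at_right 0)"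
  proof (rule tendstoI)
    fix e :: real assume e: "0 < e"
    \<comment> \<open>Here 102 = 2 * (3 * 16 + 3): squaring a sum of three terms costs a factor 3
      and the operator bound is 16, so f - g contributes less than e / 2.\<close>
    obtain g L where g: "L-lipschitz_on UNIV g" and fg: "integrable arc_length (\<lambda>w. (f w - g w)\<^sup>2)"
      "(\<integral>w. (f w - g w)\<^sup>2 \<partial>arc_length) < e / 102"
      using Lipschitz_dense_L2_arc_length[OF f] e unfolding Lipschitz_approximable_def
      by (meson zero_less_divide_iff zero_less_numeral)
    have gc: "continuous_on (sphere 0 1) g"
      using lipschitz_on_continuous_on[OF g] continuous_on_subset by blast
    then have "bounded (g ` sphere 0 1)"
      by (intro compact_imp_bounded compact_continuous_image) auto
    then obtain G where G: "\<And>w. w \<in> sphere 0 1 \<Longrightarrow> \<bar>g w\<bar> \<le> G"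
      unfolding bounded_iff by fastforce
    have gm [measurable]: "g \<in> borel_measurable arc_length"
      by (rule continuous_on_measurable_arc_length[OF gc])
    have h: "square_integrable arc_length (\<lambda>w. f w - g w)"
      using fg by (simp add: square_integrable_def)
    have g_int: "integrable arc_length g"
      by (rule continuous_on_integrable_arc_length[OF gc])
    \<comment> \<open>\<open>circle_convolution_Lipschitz\<close> compares with (1 - \<epsilon>)
      times the boundary field of g; removing that factor costs at most \<epsilon> * G. Integrating
      3 * (\<eta> \<epsilon>)^2 over total mass 2 * pi gives the factor 6 * pi below.\<close>
    define \<eta> where "\<eta> \<epsilon> = 20 * L * sqrt (1 - (1 - \<epsilon>)\<^sup>2) + \<epsilon> * G" for \<epsilon>
    have "(\<eta> \<longlongrightarrow> \<eta> 0) (at_right 0)"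
      unfolding \<eta>_def by (intro tendsto_intros)
    then have "((\<lambda>\<epsilon>. 6 * pi * (\<eta> \<epsilon>)\<^sup>2) \<longlongrightarrow> 6 * pi * (\<eta> 0)\<^sup>2) (at_right 0)"
      by (intro tendsto_intros)
    then have \<eta>: "\<forall>\<^sub>F \<epsilon> in at_right 0. 6 * pi * (\<eta> \<epsilon>)\<^sup>2 < e / 2"
      using e by (intro order_tendstoD(2)) (auto simp: \<eta>_def)
    from small \<eta> show "\<forall>\<^sub>F \<epsilon> in at_right 0. dist (\<integral>z. (cmod (V \<epsilon> z - X z))\<^sup>2 \<partial>arc_length) 0 < e"
    proof eventually_elim
      case (elim \<epsilon>)
      then have \<epsilon>: "0 \<le> 1 - \<epsilon>" "1 - \<epsilon> < 1" by auto
      let ?T = "\<lambda>f z. circle_convolution f kernel_K (of_real (1 - \<epsilon>) * z)"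
      note hT = circle_convolution_L2_bound[OF h \<epsilon>]
      let ?b = "\<lambda>z. 3 * (cmod (?T (\<lambda>w. f w - g w) z))\<^sup>2 + 3 * (f z - g z)\<^sup>2 + 3 * (\<eta> \<epsilon>)\<^sup>2"
      have bi: "integrable arc_length ?b"
        using hT(1) fg(1) by simp
      have le: "(cmod (V \<epsilon> z - X z))\<^sup>2 \<le> ?b z" if "z \<in> space arc_length" for z
      proof -
        have z: "z \<in> sphere 0 1" using that by simp
        have z1: "of_real (1 - \<epsilon>) * z \<in> ball 0 1"
          using z \<epsilon> by (simp add: norm_mult del: of_real_diff)
        have T: "?T f z = ?T (\<lambda>w. f w - g w) z + ?T g z"
          using z1 by (simp add: circle_convolution_diff f_int g_int)
        \<comment> \<open>Three errors: \<open>a\<close> is the convolution of f - g, small in the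
          mean by the uniform bound; \<open>b\<close> is the uniform boundary error for g;
          \<open>c\<close> is the error on the boundary itself, of modulus |f z - g z| because the
          rotation field has unit length there.\<close>
        define a where "a = ?T (\<lambda>w. f w - g w) z"
        define b where "b = ?T g z - of_real (g z) * rotation_field z"
        define c where "c = of_real (g z - f z) * rotation_field z"
        have "V \<epsilon> z - X z = a + b + c"
          unfolding V_def FX[OF z1] X[OF z] T a_def b_def c_def by (simp add: algebra_simps)
        then have "cmod (V \<epsilon> z - X z) \<le> cmod a + cmod b + cmod c"
          by (metis norm_triangle_ineq norm_triangle_mono order_refl)
        then have "(cmod (V \<epsilon> z - X z))\<^sup>2 \<le> (cmod a + cmod b + cmod c)\<^sup>2"
          by (intro power_mono) auto
        also have "\<dots> \<le> 3 * (cmod a)\<^sup>2 + 3 * (cmod b)\<^sup>2 + 3 * (cmod c)\<^sup>2"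
          using sum_squares_bound[of "cmod a" "cmod b"] sum_squares_bound[of "cmod b" "cmod c"]
            sum_squares_bound[of "cmod a" "cmod c"]
          by (simp add: power2_eq_square algebra_simps)
        finally have "(cmod (V \<epsilon> z - X z))\<^sup>2 \<le> 3 * (cmod a)\<^sup>2 + 3 * (cmod b)\<^sup>2 + 3 * (cmod c)\<^sup>2" .
        moreover have "cmod c = \<bar>f z - g z\<bar>"
          using z unfolding c_def rotation_field_def norm_mult norm_of_real by simp
        moreover have "cmod b \<le> \<eta> \<epsilon>"
        proof -
          have "b = (?T g z - of_real (1 - \<epsilon>) * (of_real (g z) * rotation_field z)) -
              of_real \<epsilon> * (of_real (g z) * rotation_field z)"
            by (simp add: b_def algebra_simps)
          also have "cmod \<dots> \<le> 20 * L * sqrt (1 - (1 - \<epsilon>)\<^sup>2) + cmod (of_real \<epsilon> * (of_real (g z) * rotation_field z))"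
            by (rule order_trans[OF norm_triangle_ineq4
                add_right_mono[OF circle_convolution_Lipschitz[OF g z \<epsilon>]]])
          also have "cmod (of_real \<epsilon> * (of_real (g z) * rotation_field z)) = \<epsilon> * \<bar>g z\<bar>"
            using z elim by (simp add: norm_mult rotation_field_def)
          also have "\<dots> \<le> \<epsilon> * G" using G[OF z] elim by (intro mult_left_mono) auto
          finally show ?thesis by (simp add: \<eta>_def)
        qed
        then have "(cmod b)\<^sup>2 \<le> (\<eta> \<epsilon>)\<^sup>2" by (intro power_mono) auto
        ultimately show ?thesis by (simp add: a_def)
      qed
      have Vi: "integrable arc_length (\<lambda>z. (cmod (V \<epsilon> z - X z))\<^sup>2)"
      proof (rule Bochner_Integration.integrable_bound[OF bi])
        have [measurable]: "V \<epsilon> \<in> borel_measurable arc_length"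
          using V2[of \<epsilon>] elim by (simp add: square_integrable_def)
        show "(\<lambda>z. (cmod (V \<epsilon> z - X z))\<^sup>2) \<in> borel_measurable arc_length" by measurable
        have "norm ((cmod (V \<epsilon> z - X z))\<^sup>2) \<le> norm (?b z)" if "z \<in> space arc_length" for z
          using order_trans[OF le[OF that] abs_ge_self]
          by (simp only: real_norm_def abs_of_nonneg zero_le_power2)
        then show "AE z in arc_length. norm ((cmod (V \<epsilon> z - X z))\<^sup>2) \<le> norm (?b z)"
          by (rule AE_I2)
      qed
      have "(\<integral>z. (cmod (V \<epsilon> z - X z))\<^sup>2 \<partial>arc_length) \<le> (\<integral>z. ?b z \<partial>arc_length)"
        by (rule integral_mono[OF Vi bi le])
      also have "\<dots> = 3 * (\<integral>z. (cmod (?T (\<lambda>w. f w - g w) z))\<^sup>2 \<partial>arc_length) +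
          3 * (\<integral>z. (f z - g z)\<^sup>2 \<partial>arc_length) + 3 * (\<eta> \<epsilon>)\<^sup>2 * (2 * pi)"
      proof -
        have "measure arc_length (sphere 0 1) = 2 * pi"
          by (simp add: measure_def emeasure_arc_length)
        then show ?thesis using hT(1) fg(1) by simp
      qed
      also have "\<dots> < e"
      proof -
        have "3 * (\<eta> \<epsilon>)\<^sup>2 * (2 * pi) = 6 * pi * (\<eta> \<epsilon>)\<^sup>2" by simp
        then show ?thesis using hT(2) fg(2) elim by linarith
      qed
      finally show ?case by simp
    qed
  qed
  then have "((\<lambda>\<epsilon>. L2_dist arc_length (V \<epsilon>) X) \<longlongrightarrow> sqrt 0) (at_right 0)"
    unfolding L2_dist_def by (rule tendsto_real_sqrt)
  moreover have "\<forall>\<^sub>F \<epsilon> in at_right 0. square_integrable arc_length (V \<epsilon>)"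
    using small by eventually_elim (auto intro: V2)
  ultimately have "L2_boundary_extension X FX"
    unfolding L2_boundary_extension_def L2_tendsto_def using cont X2 by (simp add: V_def)
  with smooth show ?thesis by blast
qed

end
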